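(* Let $\phi:\mathbb D_\phi\subset\mathbb D\to\mathbb E$ be Hadamard differentiable uniformly in $\rho\in\mathbb D_\rho\subset\mathbb D_\phi$ tangentially to $\mathbb D_0$ with derivative map $\phi'_\rho$. Let $r_n\to\infty$ be constants and let $\hat\rho_{n,P}=\hat\rho_{n,P}(D_{n,P})$ be estimators of $\rho_P\in\mathbb D_\rho$, taking values in $\mathbb D_\phi$, with $r_n(\hat\rho_{n,P}-\rho_P)\rightsquigarrow Z_P$ in $\mathbb D$ uniformly in $P\in\mathcal P_n$, where $Z_P$ is separable and takes values in $\mathbb D_0$ for all $P\in\mathcal P=\bigcup_{n\ge n_0}\mathcal P_n$ ($n_0$ fixed), and $\{Z_P:P\in\mathcal P\}$ is relatively compact in the topology of weak convergence in $\mathbb D_0$ (every sequence in it can be split into weakly convergent subsequences). Let $\hat\rho^*_{n,P}=\hat\rho_{n,P}+Z^*_{n,P}/r_n$ be bootstrap (or simulation) draws taking values in $\mathbb D_\phi$ such that $r_n(\hat\rho^*_{n,P}-\hat\rho_{n,P})\rightsquigarrow_BZ_P$ in $\mathbb D$ uniformly in $P\in\mathcal P_n$. Then $$X^*_{n,P}=r_n\big(\phi(\hat\rho^*_{n,P})-\phi(\hat\rho_{n,P})\big)\rightsquigarrow_BX_P=\phi'_{\rho_P}(Z_P)\quad\text{uniformly in }P\in\mathcal P_n .$$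
   Context: **Data and bootstrap.** $D_{n,P}=(W_{i,P})_{i=1}^n$ is the data vector and $B_n=(\xi_i)_{i=1}^n$ a vector of random variables used to generate bootstrap or simulation draws, independent of the data. $Z^*_{n,P}=Z_{n,P}(D_{n,P},B_n)$ is a stochastic process in $\mathbb D$ which is a measurable function of $B_n$ for each value of the data. **Convergence.** $\mathrm{BL}_1(\mathbb D)$ is the set of functions $\mathbb D\to[0,1]$ with Lipschitz norm at most 1. $X_{n,P}\rightsquigarrow Y_P$ uniformly in $P\in\mathcal P_n$: $\sup_{P\in\mathcal P_n}\sup_{h\in\mathrm{BL}_1(\mathbb D)}|\mathrm E_P^*h(X_{n,P})-\mathrm E_Ph(Y_P)|\to0$. $X^*_{n,P}\rightsquigarrow_BY_P$ uniformly in $P\in\mathcal P_n$: $\sup_{h\in\mathrm{BL}_1(\mathbb D)}|\mathrm E_{B_n}[h(X^*_{n,P})]-\mathrm E_Ph(Y_P)|=o_P^*(1)$ uniformly in $P\in\mathcal P_n$ (for every $K>0$ the supremum over $P\in\mathcal P_n$ of the outer probability that the left side exceeds $K$ tends to 0), where $\mathrm E_{B_n}$ is the expectation with respect to the law of $B_n$ holding the data fixed. **Uniform Hadamard differentiability.** $\mathbb D,\mathbb E$ are normed spaces, $\mathbb D_\phi\subset\mathbb D$, $\mathbb D_0\subset\mathbb D$ is a normed space, and $\mathbb D_\rho\subset\mathbb D_\phi$ is a compact metric space (its metric may differ from that induced by the norm of $\mathbb D$). $\phi:\mathbb D_\phi\to\mathbb E$ is Hadamard differentiable uniformly in $\rho\in\mathbb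 D_\rho$ tangentially to $\mathbb D_0$ with derivative map $h\mapsto\phi'_\rho(h)$ if $$\Big|\frac{\phi(\rho_n+t_nh_n)-\phi(\rho_n)}{t_n}-\phi'_\rho(h)\Big|\to0,\qquad|\phi'_{\rho_n}(h_n)-\phi'_\rho(h)|\to0,\qquad n\to\infty,$$ for all convergent sequences $\rho_n\to\rho$ in $\mathbb D_\rho$, $t_n\to0$ in $\mathbb R$, and $h_n\to h\in\mathbb D_0$ in $\mathbb D$ such that $\rho_n+t_nh_n\in\mathbb D_\phi$ for every $n$ (the second requirement expresses continuity of $(\rho,h)\mapsto\phi'_\rho(h)$, from $\mathbb D_\rho\times\mathbb D_0$ to $\mathbb E$, at each point). As part of the definition, $h\mapsto\phi'_\rho(h)$ from $\mathbb D_0$ to $\mathbb E$ is linear for each $\rho\in\mathbb D_\rho$. *)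

theory Defs
  imports "HOL-Probability.Probability"
begin

(* Outer expectation, intended for bounded f: then restricting to integrable real-valued majorants
   loses nothing against all extended-real measurable majorants whose integral exists.
   The library's nn_integral of a non-measurable function is the lower integral instead. *)
definition outer_expectation :: "'a measure \<Rightarrow> ('a \<Rightarrow> real) \<Rightarrow> real" where
  "outer_expectation M f =
     (INF u\<in>{u. integrable M u \<and> (\<forall>x\<in>space M. f x \<le> u x)}. integral\<^sup>L M u)"

lemma outer_expectation_eq_integral:
  assumes "integrable M f"
  shows "outer_expectation M f = integral\<^sup>L M f"
  unfolding outer_expectation_def
proof (rule cInf_eq_minimum)
  show "integral\<^sup>L M f \<in> integral\<^sup>L M ` {u. integrable M u \<and> (\<forall>x\<in>space M. f x \<le> u x)}"
    using assms by blast
  show "integral\<^sup>L M f \<le> c"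
    if "c \<in> integral\<^sup>L M ` {u. integrable M u \<and> (\<forall>x\<in>space M. f x \<le> u x)}" for c
    using that assms by (auto intro: integral_mono)
qed

(* Members may be arbitrary off S; they are only ever evaluated on S. *)
definition BL1 :: "'a::metric_space set \<Rightarrow> ('a \<Rightarrow> real) set" where
  "BL1 S = {h. (\<forall>x\<in>S. 0 \<le> h x \<and> h x \<le> 1) \<and> 1-lipschitz_on S h}"

(* P is a label: X n P lives on the probability space M P, and the limit Y P on N P.
   Suprema are taken in ennreal, so that an empty index set PP n contributes 0. *)
definition weakly_converges_unif ::
  "('p \<Rightarrow> 'w measure) \<Rightarrow> ('p \<Rightarrow> 'z measure) \<Rightarrow> (nat \<Rightarrow> 'p set) \<Rightarrow>
   (nat \<Rightarrow> 'p \<Rightarrow> 'w \<Rightarrow> 'a::metric_space) \<Rightarrow> ('p \<Rightarrow> 'z \<Rightarrow> 'a) \<Rightarrow> bool" where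
  "weakly_converges_unif M N PP X Y \<longleftrightarrow>
     (\<lambda>n. SUP P\<in>PP n. SUP h\<in>BL1 UNIV.
        ennreal \<bar>outer_expectation (M P) (\<lambda>\<omega>. h (X n P \<omega>)) - integral\<^sup>L (N P) (\<lambda>z. h (Y P z))\<bar>)
     \<longlonglongrightarrow> 0"

(* Xs n P d b is the draw computed from the data value d and the simulation value b;
   L n P is the law of b. The expectation over b is an outer one, because Xs n P d need not be
   measurable; it is the ordinary expectation when it is. As h in BL1 implies 1 - h in BL1,
   inner expectations are covered as well. *)
definition weakly_converges_boot_unif ::
  "('p \<Rightarrow> 'w measure) \<Rightarrow> (nat \<Rightarrow> 'p \<Rightarrow> 'w \<Rightarrow> 's) \<Rightarrow> (nat \<Rightarrow> 'p \<Rightarrow> 'b measure) \<Rightarrow>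
   ('p \<Rightarrow> 'z measure) \<Rightarrow> (nat \<Rightarrow> 'p set) \<Rightarrow>
   (nat \<Rightarrow> 'p \<Rightarrow> 's \<Rightarrow> 'b \<Rightarrow> 'a::metric_space) \<Rightarrow> ('p \<Rightarrow> 'z \<Rightarrow> 'a) \<Rightarrow> bool" where
  "weakly_converges_boot_unif M D L N PP Xs Y \<longleftrightarrow>
     (\<forall>K>0::real.
       (\<lambda>n. SUP P\<in>PP n. outer_measure_of (M P)
          {\<omega>\<in>space (M P). ennreal K <
             (SUP h\<in>BL1 UNIV.
                ennreal \<bar>outer_expectation (L n P) (\<lambda>b. h (Xs n P (D n P \<omega>) b))
                         - integral\<^sup>L (N P) (\<lambda>z. h (Y P z))\<bar>)})
       \<longlonglongrightarrow> 0)"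

definition separable_random_element ::
  "'z measure \<Rightarrow> ('z \<Rightarrow> 'a::metric_space) \<Rightarrow> bool" where
  "separable_random_element N Y \<longleftrightarrow>
     Y \<in> borel_measurable N \<and>
     (\<exists>S\<in>sets borel. separable_space (top_of_set S) \<and> (AE z in N. Y z \<in> S))"

(* Sequential relative compactness, in the weak topology on S, of the laws of random elements Y P
   with values in S; the limit is a Borel law Q on the subspace S, not necessarily in the family. *)
definition weakly_relatively_compact ::
  "'a::metric_space set \<Rightarrow> ('p \<Rightarrow> 'z measure) \<Rightarrow> 'p set \<Rightarrow> ('p \<Rightarrow> 'z \<Rightarrow> 'a) \<Rightarrow> bool" where
  "weakly_relatively_compact S N I Y \<longleftrightarrow>
     (\<forall>Ps :: nat \<Rightarrow> 'p. (\<forall>k. Ps k \<in> I) \<longrightarrow>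
       (\<exists>s Q. strict_mono s \<and> prob_space Q \<and> sets Q = sets (restrict_space borel S) \<and>
          (\<lambda>k. SUP h\<in>BL1 S.
             ennreal \<bar>integral\<^sup>L (N (Ps (s k))) (\<lambda>z. h (Y (Ps (s k)) z)) - integral\<^sup>L Q h\<bar>)
          \<longlonglongrightarrow> 0))"

(* D\<rho> carries its own metric, unrelated to the norm. The condition t n \<noteq> 0 makes the
   difference quotient meaningful. The last clause is joint continuity of the derivative on
   D\<rho> times D0. *)
definition unif_hadamard_differentiable ::
  "('d::real_normed_vector \<Rightarrow> 'e::real_normed_vector) \<Rightarrow> 'd set \<Rightarrow> 'd metric \<Rightarrow> 'd set \<Rightarrow>
   ('d \<Rightarrow> 'd \<Rightarrow> 'e) \<Rightarrow> bool" where
  "unif_hadamard_differentiable \<phi> D\<phi> D\<rho> D0 \<phi>' \<longleftrightarrow>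
     (\<forall>\<rho>\<in>mspace D\<rho>. \<forall>h\<in>D0. \<forall>k\<in>D0. \<forall>a b.
        \<phi>' \<rho> (a *\<^sub>R h + b *\<^sub>R k) = a *\<^sub>R \<phi>' \<rho> h + b *\<^sub>R \<phi>' \<rho> k) \<and>
     (\<forall>\<rho>s \<rho>. (\<forall>n. \<rho>s n \<in> mspace D\<rho>) \<and> limitin (mtopology_of D\<rho>) \<rho>s \<rho> sequentially \<longrightarrow>
        (\<forall>t hs h. (\<forall>n. t n \<noteq> 0) \<and> t \<longlonglongrightarrow> 0 \<and> hs \<longlonglongrightarrow> h \<and> h \<in> D0 \<and>
            (\<forall>n. \<rho>s n + t n *\<^sub>R hs n \<in> D\<phi>) \<longrightarrow>
          (\<lambda>n. norm ((\<phi> (\<rho>s n + t n *\<^sub>R hs n) - \<phi> (\<rho>s n)) /\<^sub>R t n - \<phi>' \<rho> h)) \<longlonglongrightarrow> 0) \<and>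
        (\<forall>hs h. (\<forall>n. hs n \<in> D0) \<and> hs \<longlonglongrightarrow> h \<and> h \<in> D0 \<longrightarrow>
          (\<lambda>n. norm (\<phi>' (\<rho>s n) (hs n) - \<phi>' \<rho> h)) \<longlonglongrightarrow> 0))"

definition sample_vector :: "(nat \<Rightarrow> 'w \<Rightarrow> 'x) \<Rightarrow> nat \<Rightarrow> 'w \<Rightarrow> nat \<Rightarrow> 'x" where
  "sample_vector X n \<omega> = (\<lambda>i\<in>{1..n}. X i \<omega>)"

end

theory Submission
  imports Defs
begin

text \<open>Otherwise some \<open>P\<^sub>k \<in> \<P>\<^bsub>n\<^sub>k\<^esub>\<close> violate the conclusion, and along a further subsequence
  \<open>Z\<^bsub>P\<^sub>k\<^esub>\<close> converges weakly to a law \<open>Q\<close> on \<open>D\<^sub>0\<close> and \<open>\<rho>\<^bsub>P\<^sub>k\<^esub> \<rightarrow> \<rho>\<close>. The bootstrap statistic is \<open>f\<^sub>k (U\<^sub>k, V\<^sub>k)\<close> with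
  \<open>U\<^sub>k = r\<^sub>n (\<rho>hat - \<rho>)\<close>, \<open>V\<^sub>k = Z*\<close> and
  \<open>f\<^sub>k (u, v) = r\<^sub>n (\<phi> (\<rho> + (u + v) / r\<^sub>n) - \<phi> (\<rho> + u / r\<^sub>n))\<close>, which converges continuously to
  \<open>\<phi>'\<^sub>\<rho> (u + v) - \<phi>'\<^sub>\<rho> u = \<phi>'\<^sub>\<rho> v\<close>. No tightness is available, since the spaces need be neither complete nor
  separable. Compact sets are replaced by the points around which \<open>f\<^sub>k\<close> is within \<open>\<epsilon>\<close> of its limit for all
  \<open>k \<ge> m\<close>, on balls of radius \<open>2 / (m + 1)\<close>: these sets are relatively closed and increase to \<open>D\<^sub>0 \<times> D\<^sub>0\<close>.
  For \<open>u\<close> in a closed set of large \<open>Q\<close>-measure the section at \<open>u\<close> has large \<open>Q\<close>-measure, and \<open>U\<^sub>k\<close> is close to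
  such a \<open>u\<close> with high inner probability. On the section, \<open>h \<circ> \<phi>'\<^sub>\<rho>\<close> agrees up to \<open>\<epsilon>\<close> with a Lipschitz
  function whose constant depends only on \<open>m\<close>, so the bounded Lipschitz distance between the conditional law of
  \<open>V\<^sub>k\<close> and \<open>Z\<^bsub>P\<^sub>k\<^esub>\<close> controls the error uniformly in \<open>h\<close>.\<close>

section \<open>Outer expectations and outer measures\<close>

text \<open>The constant \<open>c\<close> bounds the integrals of all majorants from below. A real
  infimum lies below its members only when such a bound exists.\<close>

lemma outer_expectation_le:
  assumes "prob_space M" "integrable M u" "\<And>x. x \<in> space M \<Longrightarrow> f x \<le> u x"
    and lower: "\<And>x. x \<in> space M \<Longrightarrow> c \<le> f x"
  shows "outer_expectation M f \<le> integral\<^sup>L M u"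
  unfolding outer_expectation_def
proof (rule cINF_lower)
  interpret prob_space M by fact
  show "bdd_below (integral\<^sup>L M ` {u. integrable M u \<and> (\<forall>x\<in>space M. f x \<le> u x)})"
  proof (rule bdd_belowI[of _ c])
    fix y assume "y \<in> integral\<^sup>L M ` {u. integrable M u \<and> (\<forall>x\<in>space M. f x \<le> u x)}"
    then obtain v where v: "y = integral\<^sup>L M v" "integrable M v" "\<forall>x\<in>space M. f x \<le> v x" by blast
    show "c \<le> y" unfolding v(1)
      using v lower by (intro integral_ge_const) (auto intro!: AE_I2 order_trans[OF lower])
  qed
qed (use assms in auto)

text \<open>The constant \<open>c\<close> is itself an integrable majorant, so the infimum is taken
  over a nonempty set.\<close>

lemma outer_expectation_ge:
  assumes "prob_space M" "integrable M l" "\<And>x. x \<in> space M \<Longrightarrow> l x \<le> f x"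
    and upper: "\<And>x. x \<in> space M \<Longrightarrow> f x \<le> c"
  shows "integral\<^sup>L M l \<le> outer_expectation M f"
  unfolding outer_expectation_def
proof (rule cINF_greatest)
  interpret prob_space M by fact
  have "(\<lambda>_. c) \<in> {u. integrable M u \<and> (\<forall>x\<in>space M. f x \<le> u x)}" using upper by auto
  then show "{u. integrable M u \<and> (\<forall>x\<in>space M. f x \<le> u x)} \<noteq> {}" by blast
  fix u assume "u \<in> {u. integrable M u \<and> (\<forall>x\<in>space M. f x \<le> u x)}"
  then show "integral\<^sup>L M l \<le> integral\<^sup>L M u"
    using assms by (intro integral_mono) (auto intro: order_trans[where y="f _"])
qed

text \<open>Markov's inequality for outer measures. Each integrable majorant \<open>u\<close> of
  \<open>f\<close> is at least \<open>c\<close> on \<open>A\<close>, so \<open>A\<close> lies in a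
  measurable superlevel set of \<open>u\<close> to which the usual inequality applies; then the
  infimum over \<open>u\<close> is taken.\<close>

lemma outer_measure_of_le_outer_expectation:
  assumes M: "prob_space M" and "c > 0" and "A \<subseteq> space M"
    and A: "\<And>x. x \<in> A \<Longrightarrow> c \<le> f x"
    and f: "\<And>x. x \<in> space M \<Longrightarrow> 0 \<le> f x" "\<And>x. x \<in> space M \<Longrightarrow> f x \<le> b"
  shows "outer_measure_of M A \<le> ennreal (outer_expectation M f / c)"
proof -
  interpret prob_space M by fact
  have upper: "enn2real (outer_measure_of M A) * c \<le> integral\<^sup>L M u"
    if u: "integrable M u" "\<And>x. x \<in> space M \<Longrightarrow> f x \<le> u x" for u
  proof -
    have [measurable]: "u \<in> borel_measurable M" using u(1) by blast
    have "outer_measure_of M A \<le> outer_measure_of M {x\<in>space M. c \<le> u x}"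
      using A u(2) \<open>A \<subseteq> space M\<close> by (intro outer_measure_of_mono) (force intro: order_trans[where y="f _"])
    also have "\<dots> = ennreal (prob {x\<in>space M. c \<le> u x})"
      by (simp add: emeasure_eq_measure)
    finally have "enn2real (outer_measure_of M A) \<le> prob {x\<in>space M. c \<le> u x}"
      using enn2real_leI by (simp add: enn2real_leI)
    also have "\<dots> \<le> integral\<^sup>L M u / c"
      using \<open>c > 0\<close> u f(1) by (intro integral_Markov_inequality_measure[where A="{}"])
        (auto intro!: AE_I2 order_trans[OF f(1) u(2)])
    finally show ?thesis using \<open>c > 0\<close> by (simp add: field_simps)
  qed
  have "(\<lambda>_. b) \<in> {u. integrable M u \<and> (\<forall>x\<in>space M. f x \<le> u x)}" using f by auto
  then have "enn2real (outer_measure_of M A) * c \<le> outer_expectation M f"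
    unfolding outer_expectation_def using upper by (intro cINF_greatest) auto
  then have "enn2real (outer_measure_of M A) \<le> outer_expectation M f / c"
    using \<open>c > 0\<close> by (simp add: pos_le_divide_eq)
  \<comment> \<open>Finiteness allows the bound on \<open>enn2real\<close> to be read back in
    \<open>ennreal\<close>, since \<open>enn2real\<close> sends infinity to 0.\<close>
  moreover have "outer_measure_of M A < \<top>"
    using outer_measure_of_mono[OF \<open>A \<subseteq> space M\<close>, of M] emeasure_eq_measure[of "space M"]
    by (simp add: order_le_less_trans[OF _ ennreal_less_top])
  ultimately show ?thesis
    by (metis ennreal_enn2real ennreal_leI)
qed

text \<open>Subadditivity is inherited from measurable hulls of the two sets that attain their outer
  measures.\<close>

lemma outer_measure_of_Un_le:
  assumes "A \<subseteq> space M" "B \<subseteq> space M"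
  shows "outer_measure_of M (A \<union> B) \<le> outer_measure_of M A + outer_measure_of M B"
proof -
  obtain A' where A': "A' \<in> sets M" "A \<subseteq> A'" "outer_measure_of M A = emeasure M A'"
    using outer_measure_of_attain[OF assms(1)] by blast
  obtain B' where B': "B' \<in> sets M" "B \<subseteq> B'" "outer_measure_of M B = emeasure M B'"
    using outer_measure_of_attain[OF assms(2)] by blast
  have "outer_measure_of M (A \<union> B) \<le> outer_measure_of M (A' \<union> B')"
    using A' B' by (intro outer_measure_of_mono) auto
  also have "\<dots> \<le> emeasure M A' + emeasure M B'"
    using A' B' by (simp add: emeasure_subadditive)
  finally show ?thesis using A' B' by simp
qed

text \<open>Non-strict bounds by positive reals are the form that splits over a supremum into bounds
  on its members.\<close>

lemma tendsto_0_ennreal_iff_le: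
  fixes f :: "'i \<Rightarrow> ennreal"
  shows "(f \<longlongrightarrow> 0) F \<longleftrightarrow> (\<forall>e>0. \<forall>\<^sub>F i in F. f i \<le> ennreal e)"
proof
  assume f: "(f \<longlongrightarrow> 0) F"
  show "\<forall>e>0. \<forall>\<^sub>F i in F. f i \<le> ennreal e"
  proof (intro allI impI)
    fix e :: real assume "e > 0"
    then have "\<forall>\<^sub>F i in F. f i < ennreal e" using f by (intro order_tendstoD) auto
    then show "\<forall>\<^sub>F i in F. f i \<le> ennreal e" by eventually_elim simp
  qed
next
  assume *: "\<forall>e>0. \<forall>\<^sub>F i in F. f i \<le> ennreal e"
  show "(f \<longlongrightarrow> 0) F"
  proof (rule order_tendstoI)
    fix a :: ennreal assume "0 < a"
    then obtain b where b: "0 < b" "b < a" using dense by blast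
    then obtain e where "b = ennreal e" "e > 0" by (cases b) auto
    then show "\<forall>\<^sub>F i in F. f i < a"
      using * b by (auto elim!: allE[of _ e] eventually_mono)
  qed auto
qed

lemma SUP_ennreal_abs_le_iff:
  assumes "0 \<le> c"
  shows "(SUP x\<in>A. ennreal \<bar>f x\<bar>) \<le> ennreal c \<longleftrightarrow> (\<forall>x\<in>A. \<bar>f x\<bar> \<le> c)"
  using assms by (simp add: SUP_le_iff)

text \<open>Turns the event that a supremum over test functions exceeds a level into the event that
  a single test function violates it.\<close>

lemma less_SUP_ennreal_abs_iff:
  assumes "0 \<le> c"
  shows "ennreal c < (SUP x\<in>A. ennreal \<bar>f x\<bar>) \<longleftrightarrow> (\<exists>x\<in>A. c < \<bar>f x\<bar>)"
  using assms by (simp add: less_SUP_iff ennreal_less_iff)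

section \<open>Bounded Lipschitz functions\<close>

lemma BL1_subset: "h \<in> BL1 T \<Longrightarrow> S \<subseteq> T \<Longrightarrow> h \<in> BL1 S"
  unfolding BL1_def by (auto intro: lipschitz_on_subset)

lemma BL1_UNIV_I:
  assumes "\<And>x. 0 \<le> h x" "\<And>x. h x \<le> 1" "\<And>x y. h x \<le> h y + dist x y"
  shows "h \<in> BL1 UNIV"
proof -
  have "dist (h x) (h y) \<le> 1 * dist x y" for x y
    using assms(3)[of x y] assms(3)[of y x] by (auto simp: dist_real_def dist_commute)
  then show ?thesis unfolding BL1_def using assms by (auto intro!: lipschitz_onI)
qed

lemma BL1_UNIV_bounds:
  assumes "h \<in> BL1 UNIV"
  shows "0 \<le> h x" "h x \<le> 1"
  using assms by (auto simp: BL1_def)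

lemma BL1_UNIV_dist: "h \<in> BL1 UNIV \<Longrightarrow> \<bar>h x - h y\<bar> \<le> dist x y"
  using lipschitz_onD[of 1 UNIV h x y] by (auto simp: BL1_def dist_real_def)

lemma BL1_UNIV_continuous_on: "h \<in> BL1 UNIV \<Longrightarrow> continuous_on A h"
  by (auto simp: BL1_def intro: continuous_on_subset[OF lipschitz_on_continuous_on])

lemma BL1_UNIV_borel_measurable [measurable_dest]:
  "h \<in> BL1 UNIV \<Longrightarrow> h \<in> borel_measurable borel"
  by (simp add: BL1_UNIV_continuous_on borel_measurable_continuous_onI)

lemma integrable_BL1_UNIV:
  assumes "prob_space M" "h \<in> BL1 UNIV" "(\<lambda>x. h (X x)) \<in> borel_measurable M"
  shows "integrable M (\<lambda>x. h (X x))"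
proof -
  interpret prob_space M by fact
  show ?thesis
    using assms BL1_UNIV_bounds[OF assms(2)] by (intro integrable_const_bound[where B=1]) auto
qed

text \<open>These truncated distances are the test functions that measure how much mass a law puts
  far from \<open>G\<close>.\<close>

lemma BL1_min_infdist:
  assumes "0 \<le> c" "c \<le> 1"
  shows "(\<lambda>x. min c (infdist x G)) \<in> BL1 UNIV"
proof (rule BL1_UNIV_I)
  show "min c (infdist x G) \<le> min c (infdist y G) + dist x y" for x y
    using infdist_triangle[of x G y] by (simp add: min_def) (smt (verit) zero_le_dist)
qed (use assms in \<open>auto simp: infdist_nonneg\<close>)

text \<open>The envelope is cut off at distance \<open>c\<close> because \<open>w \<le> 1\<close>; hence only the points of \<open>G\<close>
  within \<open>c\<close> of the argument matter.\<close>

definition lipschitz_envelope :: "real \<Rightarrow> 'a::metric_space set \<Rightarrow> ('a \<Rightarrow> real) \<Rightarrow> 'a \<Rightarrow> real" where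
  "lipschitz_envelope c G w v = (SUP a\<in>G. max 0 (c * w a - dist v a))"

section \<open>Approximation by Lipschitz envelopes and comparison of laws near a set\<close>

context
  fixes c :: real and G :: "'a::metric_space set" and w :: "'a \<Rightarrow> real"
  assumes c: "0 < c" "c \<le> 1" and G: "G \<noteq> {}"
    and w: "\<And>a. a \<in> G \<Longrightarrow> 0 \<le> w a" "\<And>a. a \<in> G \<Longrightarrow> w a \<le> 1"
begin

lemma lipschitz_envelope_term_le: "a \<in> G \<Longrightarrow> max 0 (c * w a - dist v a) \<le> c"
  using w[of a] c mult_left_mono[of "w a" 1 c] zero_le_dist[of v a] by linarith

lemma lipschitz_envelope_upper: "a \<in> G \<Longrightarrow> max 0 (c * w a - dist v a) \<le> lipschitz_envelope c G w v"
  unfolding lipschitz_envelope_def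
  using lipschitz_envelope_term_le by (intro cSUP_upper bdd_aboveI2[where M=c]) auto

lemma lipschitz_envelope_least:
  "(\<And>a. a \<in> G \<Longrightarrow> max 0 (c * w a - dist v a) \<le> b) \<Longrightarrow> lipschitz_envelope c G w v \<le> b"
  unfolding lipschitz_envelope_def using G by (intro cSUP_least)

lemma BL1_lipschitz_envelope: "lipschitz_envelope c G w \<in> BL1 UNIV"
proof (rule BL1_UNIV_I)
  fix x y
  show "0 \<le> lipschitz_envelope c G w x"
    using G lipschitz_envelope_upper[of _ x] by fastforce
  show "lipschitz_envelope c G w x \<le> 1"
    using lipschitz_envelope_least[of x c] lipschitz_envelope_term_le c by auto
  show "lipschitz_envelope c G w x \<le> lipschitz_envelope c G w y + dist x y"
  proof (rule lipschitz_envelope_least)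
    fix a assume "a \<in> G"
    have "dist y a \<le> dist x a + dist x y" by (metis add.commute dist_commute dist_triangle)
    then show "max 0 (c * w a - dist x a) \<le> lipschitz_envelope c G w y + dist x y"
      using lipschitz_envelope_upper[OF \<open>a \<in> G\<close>, of y] zero_le_dist[of x y] by linarith
  qed
qed

text \<open>For the upper bound on the envelope, points at distance at least \<open>c\<close>
  contribute 0, and nearer ones are controlled by \<open>near\<close>. Conversely each
  \<open>a\<close> in \<open>G\<close> contributes at least \<open>c * w a - dist v a\<close>, and
  the infimum over \<open>a\<close> produces \<open>infdist v G\<close>; the minimum with
  \<open>c\<close> comes from the trivial bound \<open>c * y \<le> c\<close>.\<close>

lemma lipschitz_envelope_approx:
  assumes y: "0 \<le> y" "y \<le> 1" and "0 \<le> \<epsilon>"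
    and near: "\<And>a. a \<in> G \<Longrightarrow> dist v a < c \<Longrightarrow> \<bar>y - w a\<bar> \<le> \<epsilon>"
  shows "\<bar>c * y - lipschitz_envelope c G w v\<bar> \<le> c * \<epsilon> + min c (infdist v G)"
proof -
  let ?e = "lipschitz_envelope c G w v"
  have nonneg: "0 \<le> ?e" using BL1_UNIV_bounds[OF BL1_lipschitz_envelope] by auto
  have cmul: "c * w a \<le> c" "c * y \<le> c" if "a \<in> G" for a
    using w[OF that] y c by (auto simp: mult_left_le)
  have "0 \<le> c * \<epsilon>" "0 \<le> c * y" using c assms by auto
  have close: "c * w a \<le> c * y + c * \<epsilon>" "c * y \<le> c * w a + c * \<epsilon>" if "a \<in> G" "dist v a < c" for a
    using near[OF that] c by (auto simp: abs_le_iff simp flip: distrib_left)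
  have "?e \<le> c * y + c * \<epsilon>"
  proof (rule lipschitz_envelope_least)
    fix a assume a: "a \<in> G"
    show "max 0 (c * w a - dist v a) \<le> c * y + c * \<epsilon>"
    proof (cases "dist v a < c")
      case True
      then show ?thesis using close[OF a True] \<open>0 \<le> c * \<epsilon>\<close> \<open>0 \<le> c * y\<close> zero_le_dist[of v a]
        by linarith
    next
      case False
      then show ?thesis using cmul[OF a] \<open>0 \<le> c * \<epsilon>\<close> \<open>0 \<le> c * y\<close> by linarith
    qed
  qed
  moreover have "c * y - ?e - c * \<epsilon> \<le> infdist v G"
    unfolding infdist_notempty[OF G]
  proof (rule cINF_greatest[OF G])
    fix a assume a: "a \<in> G"
    show "c * y - ?e - c * \<epsilon> \<le> dist v a"
    proof (cases "dist v a < c")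
      case True
      then show ?thesis using close[OF a True] lipschitz_envelope_upper[OF a, of v] by linarith
    next
      case False
      then show ?thesis using cmul[OF a] nonneg \<open>0 \<le> c * \<epsilon>\<close> by linarith
    qed
  qed
  moreover have "c * y - ?e \<le> c * \<epsilon> + c" using G cmul nonneg \<open>0 \<le> c * \<epsilon>\<close> by fastforce
  ultimately show ?thesis using infdist_nonneg[of v G] c by (simp add: abs_le_iff min_def)
qed

end

text \<open>No measurability of \<open>X\<close> is needed: its composition with \<open>h\<close> is sandwiched between measurable
  functions of \<open>V\<close>.\<close>

lemma BL_comparison_near_set:
  fixes V :: "'b \<Rightarrow> 'd::metric_space" and Z :: "'z \<Rightarrow> 'd" and X :: "'b \<Rightarrow> 'e::metric_space"
  assumes prob: "prob_space L" "prob_space N"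
    and meas: "V \<in> borel_measurable L" "Z \<in> borel_measurable N"
      "(\<lambda>z. h (Y z)) \<in> borel_measurable N"
    and h: "h \<in> BL1 UNIV" and C: "C \<ge> 1" and G: "G \<noteq> {}" and \<epsilon>: "\<epsilon> \<ge> 0"
    and X: "\<And>b a. b \<in> space L \<Longrightarrow> a \<in> G \<Longrightarrow> dist (V b) a < 1 / C \<Longrightarrow> dist (X b) (g a) \<le> \<epsilon>"
    and Y: "\<And>z a. z \<in> space N \<Longrightarrow> a \<in> G \<Longrightarrow> dist (Z z) a < 1 / C \<Longrightarrow> dist (Y z) (g a) \<le> \<epsilon>"
    and VZ: "\<And>f. f \<in> BL1 UNIV \<Longrightarrow>
      \<bar>integral\<^sup>L L (\<lambda>b. f (V b)) - integral\<^sup>L N (\<lambda>z. f (Z z))\<bar> \<le> \<kappa>"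
  shows "\<bar>outer_expectation L (\<lambda>b. h (X b)) - integral\<^sup>L N (\<lambda>z. h (Y z))\<bar>
    \<le> 2 * \<epsilon> + 2 * C * \<kappa> + 2 * C * integral\<^sup>L N (\<lambda>z. min (1 / C) (infdist (Z z) G))"
proof -
  interpret L: prob_space L by fact
  interpret N: prob_space N by fact
  define c where "c = 1 / C"
  have c: "0 < c" "c \<le> 1" and Cc: "C * c = 1" using C by (auto simp: c_def)
  define w where "w = (\<lambda>a. h (g a))"
  have w: "0 \<le> w a" "w a \<le> 1" for a unfolding w_def using BL1_UNIV_bounds[OF h] by auto
  define e where "e = lipschitz_envelope c G w"
  define d where "d = (\<lambda>v. min c (infdist v G))"
  have e: "e \<in> BL1 UNIV" unfolding e_def using BL1_lipschitz_envelope[OF c G] w by blast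
  have d: "d \<in> BL1 UNIV" unfolding d_def using c by (intro BL1_min_infdist) auto
  have [measurable]: "e \<in> borel_measurable borel" "d \<in> borel_measurable borel"
    using e d by (auto intro: BL1_UNIV_borel_measurable)
  note [measurable] = meas
  have int: "integrable L (\<lambda>b. e (V b))" "integrable L (\<lambda>b. d (V b))"
    "integrable N (\<lambda>z. e (Z z))" "integrable N (\<lambda>z. d (Z z))" "integrable N (\<lambda>z. h (Y z))"
    by (rule integrable_BL1_UNIV[OF prob(1) e] integrable_BL1_UNIV[OF prob(1) d]
        integrable_BL1_UNIV[OF prob(2) e] integrable_BL1_UNIV[OF prob(2) d]
        integrable_BL1_UNIV[OF prob(2) h], measurable)+
  \<comment> \<open>The envelope estimate at scale \<open>c\<close>, multiplied by
    \<open>C = 1 / c\<close>. It applies both to \<open>X\<close> over \<open>V\<close> and to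
    \<open>Y\<close> over \<open>Z\<close>, because both are close to \<open>g\<close> on
    \<open>G\<close>.\<close>
  have approx: "\<bar>h x - C * e v\<bar> \<le> \<epsilon> + C * d v"
    if "\<And>a. a \<in> G \<Longrightarrow> dist v a < 1 / C \<Longrightarrow> dist x (g a) \<le> \<epsilon>" for x v
  proof -
    have "\<bar>h x - w a\<bar> \<le> \<epsilon>" if "a \<in> G" "dist v a < c" for a
      using BL1_UNIV_dist[OF h, of x "g a"] \<open>\<And>a. a \<in> G \<Longrightarrow> dist v a < 1 / C \<Longrightarrow> dist x (g a) \<le> \<epsilon>\<close>[of a] that
      unfolding c_def w_def by linarith
    then have "\<bar>c * h x - e v\<bar> \<le> c * \<epsilon> + d v"
      unfolding e_def d_def using BL1_UNIV_bounds[OF h] \<epsilon> w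
      by (intro lipschitz_envelope_approx[OF c G]) auto
    then have "C * \<bar>c * h x - e v\<bar> \<le> C * (c * \<epsilon> + d v)" using C by (intro mult_left_mono) auto
    moreover have "C * \<bar>c * h x - e v\<bar> = \<bar>C * (c * h x - e v)\<bar>" using C by (simp add: abs_mult)
    moreover have "C * (c * h x - e v) = h x - C * e v" "C * (c * \<epsilon> + d v) = \<epsilon> + C * d v"
      using Cc by (simp_all add: right_diff_distrib distrib_left flip: mult.assoc)
    ultimately show ?thesis by simp
  qed
  have "outer_expectation L (\<lambda>b. h (X b)) \<le> integral\<^sup>L L (\<lambda>b. C * e (V b) + (\<epsilon> + C * d (V b)))"
    using int BL1_UNIV_bounds[OF h] approx[OF X]
    by (intro outer_expectation_le[OF prob(1), where c=0]) (auto simp: abs_le_iff algebra_simps)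
  then have up: "outer_expectation L (\<lambda>b. h (X b))
      \<le> C * integral\<^sup>L L (\<lambda>b. e (V b)) + \<epsilon> + C * integral\<^sup>L L (\<lambda>b. d (V b))"
    using int by (simp add: L.prob_space)
  have "integral\<^sup>L L (\<lambda>b. C * e (V b) - (\<epsilon> + C * d (V b))) \<le> outer_expectation L (\<lambda>b. h (X b))"
    using int BL1_UNIV_bounds[OF h] approx[OF X]
    by (intro outer_expectation_ge[OF prob(1), where c=1]) (auto simp: abs_le_iff algebra_simps)
  then have lo: "C * integral\<^sup>L L (\<lambda>b. e (V b)) - \<epsilon> - C * integral\<^sup>L L (\<lambda>b. d (V b))
      \<le> outer_expectation L (\<lambda>b. h (X b))"
    using int by (simp add: L.prob_space)
  have "integral\<^sup>L N (\<lambda>z. h (Y z)) \<le> integral\<^sup>L N (\<lambda>z. C * e (Z z) + (\<epsilon> + C * d (Z z)))"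
    using int approx[OF Y] by (intro integral_mono) (auto simp: abs_le_iff algebra_simps)
  then have upN: "integral\<^sup>L N (\<lambda>z. h (Y z))
      \<le> C * integral\<^sup>L N (\<lambda>z. e (Z z)) + \<epsilon> + C * integral\<^sup>L N (\<lambda>z. d (Z z))"
    using int by (simp add: N.prob_space)
  have "integral\<^sup>L N (\<lambda>z. C * e (Z z) - (\<epsilon> + C * d (Z z))) \<le> integral\<^sup>L N (\<lambda>z. h (Y z))"
    using int approx[OF Y] by (intro integral_mono) (auto simp: abs_le_iff algebra_simps)
  then have loN: "C * integral\<^sup>L N (\<lambda>z. e (Z z)) - \<epsilon> - C * integral\<^sup>L N (\<lambda>z. d (Z z))
      \<le> integral\<^sup>L N (\<lambda>z. h (Y z))"
    using int by (simp add: N.prob_space)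
  \<comment> \<open>Applied to the envelope \<open>e\<close> and to the penalty \<open>d\<close>,
    which moves both from \<open>L\<close> to \<open>N\<close>. Hence
    \<open>2 * C * \<kappa>\<close>, while the other factors 2 arise because the approximation error
    is paid under each law.\<close>
  have scaled: "\<bar>C * integral\<^sup>L L (\<lambda>b. f (V b)) - C * integral\<^sup>L N (\<lambda>z. f (Z z))\<bar> \<le> C * \<kappa>"
    if "f \<in> BL1 UNIV" for f
    using mult_left_mono[OF VZ[OF that], of C] C by (simp add: abs_mult flip: right_diff_distrib)
  show ?thesis
    using up lo upN loN scaled[OF e] scaled[OF d] unfolding d_def c_def by linarith
qed

section \<open>Relatively closed sets under a law on a subspace\<close>

lemma closedin_top_of_set_sequentiallyI:
  fixes S :: "'a::metric_space set"
  assumes "A \<subseteq> S" "\<And>x l. (\<And>n::nat. x n \<in> A) \<Longrightarrow> x \<longlonglongrightarrow> l \<Longrightarrow> l \<in> S \<Longrightarrow> l \<in> A"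
  shows "closedin (top_of_set S) A"
proof -
  have "l \<in> A" if "l \<in> S" "l \<in> closure A" for l
    using that assms(2) unfolding closure_sequential by blast
  then have "A = S \<inter> closure A" using assms(1) closure_subset[of A] by blast
  then show ?thesis by (metis closed_closure closedin_closed_Int)
qed

lemma closedin_top_of_set_sequentiallyD:
  fixes S :: "'a::metric_space set"
  assumes "closedin (top_of_set S) A" "\<And>n::nat. x n \<in> A" "x \<longlonglongrightarrow> l" "l \<in> S"
  shows "l \<in> A"
  using assms by (metis (no_types, lifting) IntD2 IntI closed_sequentially closedin_closed)

lemma sets_restrict_borel_closedin:
  assumes "closedin (top_of_set S) A" "sets Q = sets (restrict_space borel S)"
  shows "A \<in> sets Q"
proof -
  obtain T where "closed T" "A = S \<inter> T" using assms(1) by (auto simp: closedin_closed)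
  then show ?thesis using assms(2) by (auto simp: sets_restrict_space)
qed

text \<open>A substitute for Fubini's theorem in a possibly non-separable space, where the product of the
  Borel \<open>\<sigma>\<close>-algebras may miss closed sets: the set of \<open>u\<close> whose section has large measure is itself
  closed, because a limsup of sections is contained in the limit section.\<close>

lemma closed_exhaustion_sections:
  fixes S :: "'a::metric_space set" and R :: "nat \<Rightarrow> ('a \<times> 'a) set"
  assumes Q: "prob_space Q" "sets Q = sets (restrict_space borel S)"
    and closed: "\<And>m. closedin (top_of_set (S \<times> S)) (R m)" and inc: "incseq R"
    and cover: "S \<times> S \<subseteq> (\<Union>m. R m)" and \<eta>: "\<eta> > 0"
  obtains m where
    "closedin (top_of_set S) {u\<in>S. 1 - \<eta> \<le> measure Q (R m `` {u})}"
    "1 - \<eta> \<le> measure Q {u\<in>S. 1 - \<eta> \<le> measure Q (R m `` {u})}"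
    "\<And>u. u \<in> S \<Longrightarrow> closedin (top_of_set S) (R m `` {u})"
proof -
  interpret prob_space Q by fact
  have space: "space Q = S" using sets_eq_imp_space_eq[OF Q(2)] by (simp add: space_restrict_space)
  have sub: "R m \<subseteq> S \<times> S" for m using closedin_imp_subset[OF closed] .
  have exhaust: "\<exists>m. 1 - \<eta> \<le> prob (A m)"
    if "\<And>m::nat. A m \<in> sets Q" "incseq A" "S \<subseteq> (\<Union>m. A m)" for A
  proof -
    have "(\<Union>m. A m) = space Q" using that sets.sets_into_space space by blast
    then have "(\<lambda>m. prob (A m)) \<longlonglongrightarrow> 1"
      using finite_Lim_measure_incseq[of A] that prob_space by auto
    then have "eventually (\<lambda>m. 1 - \<eta> < prob (A m)) sequentially"
      using \<eta> by (intro order_tendstoD) auto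
    then show ?thesis by (auto simp: eventually_sequentially intro: less_imp_le)
  qed
  \<comment> \<open>Joint relative closedness of \<open>R m\<close>; it yields closed sections and
    the containment of limsups of sections.\<close>
  have limit: "v \<in> R m `` {u}"
    if "\<And>n. (us n, vs n) \<in> R m" "us \<longlonglongrightarrow> u" "vs \<longlonglongrightarrow> v" "u \<in> S" "v \<in> S"
    for m us vs u v
    using closedin_top_of_set_sequentiallyD[OF closed that(1) tendsto_Pair[OF that(2,3)]] that(4,5)
    by simp
  have section_closed: "closedin (top_of_set S) (R m `` {u})" if "u \<in> S" for m u
  proof (rule closedin_top_of_set_sequentiallyI)
    fix x l assume x: "\<And>n. x n \<in> R m `` {u}" "x \<longlonglongrightarrow> l" "l \<in> S"
    have "(u, x n) \<in> R m" for n using x(1) by blast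
    then show "l \<in> R m `` {u}" by (rule limit[OF _ tendsto_const x(2) that x(3)])
  qed (use sub in auto)
  note section_sets = sets_restrict_borel_closedin[OF section_closed Q(2)]
  define F where "F = (\<lambda>m. {u\<in>S. 1 - \<eta> \<le> prob (R m `` {u})})"
  have F_closed: "closedin (top_of_set S) (F m)" for m
  proof (rule closedin_top_of_set_sequentiallyI)
    fix us u assume us: "\<And>n. us n \<in> F m" "us \<longlonglongrightarrow> u" and u: "u \<in> S"
    have usS: "us n \<in> S" for n using us(1) by (auto simp: F_def)
    \<comment> \<open>Tail unions, whose intersection is the limsup of the sections. Each has mass
      at least \<open>1 - \<eta>\<close>, and continuity from above preserves this bound.\<close>
    define A where "A = (\<lambda>n. \<Union>j\<in>{n..}. R m `` {us j})"
    have A_sets: "A n \<in> sets Q" for n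
      unfolding A_def using section_sets usS by (intro sets.countable_UN'') auto
    have "decseq A" unfolding A_def by (intro antimonoI UN_mono) auto
    then have lim: "(\<lambda>n. prob (A n)) \<longlonglongrightarrow> prob (\<Inter>n. A n)"
      using A_sets by (intro finite_Lim_measure_decseq) auto
    have "1 - \<eta> \<le> prob (A n)" for n
    proof -
      have "1 - \<eta> \<le> prob (R m `` {us n})" using us(1) by (auto simp: F_def)
      also have "\<dots> \<le> prob (A n)" using A_sets by (intro finite_measure_mono) (auto simp: A_def)
      finally show ?thesis .
    qed
    then have "1 - \<eta> \<le> prob (\<Inter>n. A n)" using lim by (intro LIMSEQ_le_const) auto
    also have "\<dots> \<le> prob (R m `` {u})"
    proof (rule finite_measure_mono)
      show "(\<Inter>n. A n) \<subseteq> R m `` {u}"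
      proof
        fix v assume v: "v \<in> (\<Inter>n. A n)"
        \<comment> \<open>A point of the limsup lies in sections with arbitrarily large index, so
          the base points of those sections still converge to \<open>u\<close>.\<close>
        then have "\<forall>n. \<exists>j\<ge>n. (us j, v) \<in> R m" by (auto simp: A_def)
        then obtain j where j: "\<And>n. j n \<ge> n" "\<And>n. (us (j n), v) \<in> R m" by metis
        have "(\<lambda>n. us (j n)) \<longlonglongrightarrow> u"
          using j(1)
          by (intro filterlim_compose[OF us(2)] filterlim_at_top_mono[OF filterlim_ident]) auto
        moreover have "v \<in> S" using j(2) sub by blast
        ultimately show "v \<in> R m `` {u}" using limit[of "\<lambda>n. us (j n)" "\<lambda>_. v"] j(2) u by auto
      qed
    qed (use section_sets u in auto)
    finally show "u \<in> F m" using u by (auto simp: F_def)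
  qed (auto simp: F_def)
  have "incseq F"
  proof (rule incseq_SucI)
    fix m
    have "prob (R m `` {u}) \<le> prob (R (Suc m) `` {u})" if "u \<in> S" for u
      using incseqD[OF inc, of m "Suc m"] section_sets[OF that]
      by (intro finite_measure_mono) auto
    then show "F m \<subseteq> F (Suc m)" unfolding F_def by fastforce
  qed
  moreover have "S \<subseteq> (\<Union>m. F m)"
  proof
    fix u assume u: "u \<in> S"
    have "\<exists>m. 1 - \<eta> \<le> prob (R m `` {u})"
    proof (rule exhaust)
      show "incseq (\<lambda>m. R m `` {u})" using inc by (auto simp: incseq_def)
      show "S \<subseteq> (\<Union>m. R m `` {u})" using cover u by blast
    qed (use section_sets u in auto)
    then show "u \<in> (\<Union>m. F m)" using u by (auto simp: F_def)
  qed
  \<comment> \<open>One index serves for the base set and for all sections over it, since the lower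
    bound on the sections is built into \<open>F m\<close>.\<close>
  ultimately obtain m where "1 - \<eta> \<le> prob (F m)"
    using exhaust[of F] sets_restrict_borel_closedin[OF F_closed Q(2)] by blast
  with that[of m] F_closed[of m] section_closed show thesis by (auto simp: F_def)
qed

text \<open>The integrand vanishes on \<open>G\<close> and is at most \<open>c\<close> elsewhere.
  With \<open>c = 1 / C\<close> a later multiplication by \<open>C\<close> leaves
  \<open>\<eta>\<close>, whatever \<open>C\<close> is.\<close>

lemma integral_min_infdist_le:
  assumes Q: "prob_space Q" "sets Q = sets (restrict_space borel S)"
    and G: "closedin (top_of_set S) G" "1 - \<eta> \<le> measure Q G" and c: "0 \<le> c"
  shows "integral\<^sup>L Q (\<lambda>x. min c (infdist x G)) \<le> c * \<eta>"
proof -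
  interpret prob_space Q by fact
  have G_sets: "G \<in> sets Q" using sets_restrict_borel_closedin[OF G(1) Q(2)] .
  have "integral\<^sup>L Q (\<lambda>x. min c (infdist x G)) \<le> integral\<^sup>L Q (\<lambda>x. c * indicator (space Q - G) x)"
  proof (rule integral_mono')
    show "integrable Q (\<lambda>x. c * indicator (space Q - G) x)"
      using G_sets by (intro integrable_mult_right integrable_real_indicator) (auto simp: emeasure_eq_measure)
  qed (use c in \<open>auto simp: indicator_def infdist_nonneg\<close>)
  also have "\<dots> = c * (1 - prob G)" using G_sets by (simp add: prob_compl)
  also have "\<dots> \<le> c * \<eta>" using G(2) c by (intro mult_left_mono) auto
  finally show ?thesis .
qed

section \<open>The conditional extended continuous mapping principle\<close>

text \<open>\<open>A k\<close> is the domain on which \<open>f k\<close> is controlled. The radius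
  is twice \<open>1 / (m + 1)\<close>, so that a pair whose coordinates are each within
  \<open>1 / (m + 1)\<close> of those of the centre still falls inside. Open balls together with a
  non-strict error bound make the set relatively closed.\<close>

definition stable_points ::
  "(nat \<Rightarrow> 'a \<Rightarrow> 'e::metric_space) \<Rightarrow> (nat \<Rightarrow> 'a set) \<Rightarrow> ('a \<Rightarrow> 'e) \<Rightarrow> 'a set \<Rightarrow> real \<Rightarrow> nat \<Rightarrow>
    'a::metric_space set" where
  "stable_points f A g T \<epsilon> m =
     {x\<in>T. \<forall>k\<ge>m. \<forall>y\<in>A k. dist y x < 2 / real (Suc m) \<longrightarrow> dist (f k y) (g x) \<le> \<epsilon>}"

text \<open>A point \<open>y\<close> of the open ball around the limit \<open>x\<close> is
  eventually in the balls around \<open>xs n\<close>, and continuity of \<open>g\<close> carries the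
  error bound to the limit.\<close>

lemma closedin_stable_points:
  assumes g: "continuous_on T g"
  shows "closedin (top_of_set T) (stable_points f A g T \<epsilon> m)"
proof (rule closedin_top_of_set_sequentiallyI)
  fix xs x assume xs: "\<And>n. xs n \<in> stable_points f A g T \<epsilon> m" "xs \<longlonglongrightarrow> x" and x: "x \<in> T"
  have g_lim: "(\<lambda>n. g (xs n)) \<longlonglongrightarrow> g x"
    using xs x by (intro continuous_on_tendsto_compose[OF g]) (auto simp: stable_points_def)
  have "dist (f k y) (g x) \<le> \<epsilon>" if "k \<ge> m" "y \<in> A k" "dist y x < 2 / real (Suc m)" for k y
  proof (rule tendsto_upperbound)
    show "(\<lambda>n. dist (f k y) (g (xs n))) \<longlonglongrightarrow> dist (f k y) (g x)"
      by (intro tendsto_intros g_lim)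
    have "(\<lambda>n. dist y (xs n)) \<longlonglongrightarrow> dist y x" by (intro tendsto_intros xs(2))
    then have "\<forall>\<^sub>F n in sequentially. dist y (xs n) < 2 / real (Suc m)"
      using that(3) by (rule order_tendstoD)
    then show "\<forall>\<^sub>F n in sequentially. dist (f k y) (g (xs n)) \<le> \<epsilon>"
      by eventually_elim (use xs(1) that(1,2) in \<open>auto simp: stable_points_def\<close>)
  qed simp
  then show "x \<in> stable_points f A g T \<epsilon> m" using x by (auto simp: stable_points_def)
qed (auto simp: stable_points_def)

lemma incseq_stable_points: "incseq (stable_points f A g T \<epsilon>)"
proof (rule incseq_SucI)
  fix m
  have "2 / real (Suc (Suc m)) \<le> 2 / real (Suc m)" by (simp add: frac_le)
  then show "stable_points f A g T \<epsilon> m \<subseteq> stable_points f A g T \<epsilon> (Suc m)"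
    by (auto simp: stable_points_def simp del: of_nat_Suc)
qed

text \<open>At a point in none of the sets, a violating pair chosen for every \<open>m\<close> gives
  a sequence that contradicts continuous convergence.\<close>

lemma stable_points_exhaust:
  assumes lim: "\<And>\<kappa> xs x. (\<And>n. n \<le> \<kappa> n) \<Longrightarrow> (\<And>n. xs n \<in> A (\<kappa> n)) \<Longrightarrow> xs \<longlonglongrightarrow> x \<Longrightarrow> x \<in> T \<Longrightarrow>
      (\<lambda>n. f (\<kappa> n) (xs n)) \<longlonglongrightarrow> g x"
    and "\<epsilon> > 0"
  shows "T \<subseteq> (\<Union>m. stable_points f A g T \<epsilon> m)"
proof (rule ccontr)
  assume "\<not> ?thesis"
  then obtain x where x: "x \<in> T" "\<And>m. x \<notin> stable_points f A g T \<epsilon> m" by blast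
  have "\<exists>k y. m \<le> k \<and> y \<in> A k \<and> dist y x < 2 / real (Suc m) \<and> \<epsilon> < dist (f k y) (g x)" for m
    using x(1) x(2)[of m] by (auto simp: stable_points_def not_le simp del: of_nat_Suc)
  then obtain \<kappa> xs where xs: "\<And>m. m \<le> \<kappa> m" "\<And>m. xs m \<in> A (\<kappa> m)"
    "\<And>m. dist (xs m) x < 2 / real (Suc m)" "\<And>m. \<epsilon> < dist (f (\<kappa> m) (xs m)) (g x)"
    by metis
  have "(\<lambda>m. 2 / real (Suc m)) \<longlonglongrightarrow> 0"
    using tendsto_mult_right_zero[OF LIMSEQ_inverse_real_of_nat, of 2] by (simp only: divide_inverse)
  then have "(\<lambda>m. dist (xs m) x) \<longlonglongrightarrow> 0"
    by (rule Lim_null_comparison[rotated]) (simp add: less_imp_le[OF xs(3)] del: of_nat_Suc)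
  then have "xs \<longlonglongrightarrow> x" by (rule tendsto_dist_iff[THEN iffD2])
  then have "(\<lambda>m. dist (f (\<kappa> m) (xs m)) (g x)) \<longlonglongrightarrow> 0"
    by (intro tendsto_dist_iff[THEN iffD1] lim xs(1,2) x(1))
  then have "\<forall>\<^sub>F m in sequentially. dist (f (\<kappa> m) (xs m)) (g x) < \<epsilon>"
    using \<open>\<epsilon> > 0\<close> by (rule order_tendstoD)
  then obtain m where "dist (f (\<kappa> m) (xs m)) (g x) < \<epsilon>" by (auto simp: eventually_sequentially)
  then show False using xs(4)[of m] by simp
qed

text \<open>The probabilistic core, free of derivatives. The limit \<open>g (snd x)\<close> ignores
  the first coordinate, so the law of \<open>U\<close> only has to place \<open>U\<close> near a
  good set. Both \<open>f\<close> and \<open>\<psi>\<close> approach \<open>g\<close>, which allows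
  the target \<open>\<psi> k\<close> to vary with \<open>k\<close>.\<close>

lemma conditional_extended_continuous_mapping:
  fixes U :: "nat \<Rightarrow> 'w \<Rightarrow> 'd::metric_space" and V :: "nat \<Rightarrow> 'w \<Rightarrow> 'b \<Rightarrow> 'd"
    and Z :: "nat \<Rightarrow> 'z \<Rightarrow> 'd" and f :: "nat \<Rightarrow> 'd \<times> 'd \<Rightarrow> 'e::metric_space" and g :: "'d \<Rightarrow> 'e"
  assumes prob: "\<And>k. prob_space (M k)" "\<And>k. prob_space (L k)" "\<And>k. prob_space (N k)"
    and V: "\<And>k \<omega>. \<omega> \<in> space (M k) \<Longrightarrow> V k \<omega> \<in> borel_measurable (L k)"
    and Z: "\<And>k. Z k \<in> borel_measurable (N k)" "\<And>k z. z \<in> space (N k) \<Longrightarrow> Z k z \<in> S"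
    and Q: "prob_space Q" "sets Q = sets (restrict_space borel S)"
    and cont: "continuous_on S g" "\<And>k. continuous_on S (\<psi> k)"
    and UV: "\<And>k \<omega> b. \<omega> \<in> space (M k) \<Longrightarrow> b \<in> space (L k) \<Longrightarrow> (U k \<omega>, V k \<omega> b) \<in> A k"
    and f_lim: "\<And>\<kappa> xs x. (\<And>n. n \<le> \<kappa> n) \<Longrightarrow> (\<And>n. xs n \<in> A (\<kappa> n)) \<Longrightarrow> xs \<longlonglongrightarrow> x \<Longrightarrow> x \<in> S \<times> S \<Longrightarrow>
      (\<lambda>n. f (\<kappa> n) (xs n)) \<longlonglongrightarrow> g (snd x)"
    and \<psi>_lim: "\<And>\<kappa> xs x. (\<And>n. n \<le> \<kappa> n) \<Longrightarrow> (\<And>n. xs n \<in> S) \<Longrightarrow> xs \<longlonglongrightarrow> x \<Longrightarrow> x \<in> S \<Longrightarrow>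
      (\<lambda>n. \<psi> (\<kappa> n) (xs n)) \<longlonglongrightarrow> g x"
    and ZQ: "\<And>\<kappa>. \<kappa> > 0 \<Longrightarrow> \<forall>\<^sub>F k in sequentially. \<forall>h\<in>BL1 S.
      \<bar>integral\<^sup>L (N k) (\<lambda>z. h (Z k z)) - integral\<^sup>L Q h\<bar> \<le> \<kappa>"
    and UZ: "\<And>\<kappa>. \<kappa> > 0 \<Longrightarrow> \<forall>\<^sub>F k in sequentially. \<forall>h\<in>BL1 UNIV.
      \<bar>outer_expectation (M k) (\<lambda>\<omega>. h (U k \<omega>)) - integral\<^sup>L (N k) (\<lambda>z. h (Z k z))\<bar> \<le> \<kappa>"
    and VZ: "\<And>\<kappa> e. \<kappa> > 0 \<Longrightarrow> e > 0 \<Longrightarrow> \<forall>\<^sub>F k in sequentially.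
      outer_measure_of (M k) {\<omega>\<in>space (M k). \<exists>h\<in>BL1 UNIV. \<kappa> <
        \<bar>outer_expectation (L k) (\<lambda>b. h (V k \<omega> b)) - integral\<^sup>L (N k) (\<lambda>z. h (Z k z))\<bar>} \<le> ennreal e"
    and K: "K > 0" and e: "e > 0"
  shows "\<forall>\<^sub>F k in sequentially.
    outer_measure_of (M k) {\<omega>\<in>space (M k). \<exists>h\<in>BL1 UNIV. K <
      \<bar>outer_expectation (L k) (\<lambda>b. h (f k (U k \<omega>, V k \<omega> b)))
        - integral\<^sup>L (N k) (\<lambda>z. h (\<psi> k (Z k z)))\<bar>} \<le> ennreal e"
proof -
  \<comment> \<open>Budget for \<open>K\<close>: \<open>2 * \<epsilon>\<close> and
    \<open>2 * C * \<kappa>\<close> cost at most \<open>K / 4\<close> each, and the tail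
    \<open>2 * (\<eta> + C * \<kappa>)\<close> at most \<open>K / 2\<close>. For \<open>e\<close>,
    the events \<open>?farU\<close> and \<open>?farV\<close> cost \<open>e / 2\<close> each. The
    bound \<open>1 / 2\<close> on \<open>\<eta>\<close> forces sets of mass at least
    \<open>1 - \<eta>\<close> to be nonempty.\<close>
  define \<epsilon> where "\<epsilon> = K / 8"
  define \<eta> where "\<eta> = min (min (K / 8) (e / 4)) (1 / 2)"
  have pos: "\<epsilon> > 0" "\<eta> > 0" using K e by (auto simp: \<epsilon>_def \<eta>_def)
  define Rf where "Rf = stable_points f A (g \<circ> snd) (S \<times> S) \<epsilon>"
  define R\<psi> where "R\<psi> = stable_points \<psi> (\<lambda>_. S) g S \<epsilon>"
  define R where "R = (\<lambda>m. Rf m \<inter> S \<times> R\<psi> m)"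
  have closed: "closedin (top_of_set (S \<times> S)) (R m)" for m
    unfolding R_def
  proof (rule closedin_Int)
    show "closedin (top_of_set (S \<times> S)) (Rf m)"
      unfolding Rf_def by (intro closedin_stable_points continuous_on_compose continuous_intros)
        (rule continuous_on_subset[OF cont(1)], auto)
    show "closedin (top_of_set (S \<times> S)) (S \<times> R\<psi> m)"
      unfolding R\<psi>_def by (intro closedin_Times closedin_stable_points cont) auto
  qed
  have inc: "incseq R"
    using incseq_stable_points[of f A "g \<circ> snd" "S \<times> S" \<epsilon>] incseq_stable_points[of \<psi> "\<lambda>_. S" g S \<epsilon>]
    unfolding R_def Rf_def R\<psi>_def incseq_def by blast
  have cover: "S \<times> S \<subseteq> (\<Union>m. R m)"
  proof clarify
    fix u v assume uv: "u \<in> S" "v \<in> S"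
    have "S \<times> S \<subseteq> (\<Union>m. Rf m)"
      unfolding Rf_def using f_lim pos(1) by (intro stable_points_exhaust) (auto simp: o_def)
    then obtain m where "(u, v) \<in> Rf m" using uv by blast
    moreover have "S \<subseteq> (\<Union>m. R\<psi> m)"
      unfolding R\<psi>_def using \<psi>_lim pos(1) by (intro stable_points_exhaust) auto
    then obtain m' where "v \<in> R\<psi> m'" using uv by blast
    moreover have "Rf m \<subseteq> Rf (max m m')" "R\<psi> m' \<subseteq> R\<psi> (max m m')"
      unfolding Rf_def R\<psi>_def by (simp_all add: incseqD[OF incseq_stable_points])
    ultimately show "(u, v) \<in> (\<Union>m. R m)" using uv unfolding R_def by blast
  qed
  obtain m where m: "closedin (top_of_set S) {u\<in>S. 1 - \<eta> \<le> measure Q (R m `` {u})}"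
    "1 - \<eta> \<le> measure Q {u\<in>S. 1 - \<eta> \<le> measure Q (R m `` {u})}"
    "\<And>u. u \<in> S \<Longrightarrow> closedin (top_of_set S) (R m `` {u})"
    using closed_exhaustion_sections[OF Q closed inc cover pos(2)] by blast
  define F where "F = {u\<in>S. 1 - \<eta> \<le> measure Q (R m `` {u})}"
  define C where "C = real (Suc m)"
  have C: "C \<ge> 1" "C > 0" by (auto simp: C_def)
  \<comment> \<open>Chosen after \<open>m\<close>, because the Lipschitz constant \<open>C\<close>
    of the comparison depends on \<open>m\<close>.\<close>
  define \<kappa> where "\<kappa> = min (K / 8) (e / 8) / C"
  have \<kappa>: "\<kappa> > 0" "C * \<kappa> \<le> K / 8" "C * \<kappa> \<le> e / 8" using K e C by (auto simp: \<kappa>_def)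
  have \<eta>: "\<eta> \<le> K / 8" "\<eta> \<le> e / 4" "\<eta> < 1" by (auto simp: \<eta>_def)
  have nonempty: "G \<noteq> {}" if "1 - \<eta> \<le> measure Q G" for G using that \<eta>(3) by auto
  have F: "closedin (top_of_set S) F" "1 - \<eta> \<le> measure Q F" "F \<noteq> {}"
    using m nonempty unfolding F_def by auto
  \<comment> \<open>The mass far from \<open>G\<close> is bounded under \<open>Q\<close> and
    transferred to \<open>N k\<close> by the bounded Lipschitz distance.\<close>
  have tail: "C * integral\<^sup>L (N k) (\<lambda>z. min (1 / C) (infdist (Z k z) G)) \<le> \<eta> + C * \<kappa>"
    if G: "closedin (top_of_set S) G" "1 - \<eta> \<le> measure Q G"
      and k: "\<forall>h\<in>BL1 S. \<bar>integral\<^sup>L (N k) (\<lambda>z. h (Z k z)) - integral\<^sup>L Q h\<bar> \<le> \<kappa>" for G k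
  proof -
    have "(\<lambda>x. min (1 / C) (infdist x G)) \<in> BL1 S"
      using C by (intro BL1_subset[OF BL1_min_infdist]) auto
    then have "integral\<^sup>L (N k) (\<lambda>z. min (1 / C) (infdist (Z k z) G)) \<le> 1 / C * \<eta> + \<kappa>"
      using bspec[OF k, of "\<lambda>x. min (1 / C) (infdist x G)"] integral_min_infdist_le[OF Q G, of "1 / C"] C
      by auto
    then have "C * integral\<^sup>L (N k) (\<lambda>z. min (1 / C) (infdist (Z k z) G)) \<le> C * (1 / C * \<eta> + \<kappa>)"
      using C by (intro mult_left_mono) auto
    also have "\<dots> = \<eta> + C * \<kappa>" using C by (simp add: field_simps)
    finally show ?thesis .
  qed
  have "e / 2 > 0" using e by simp
  from eventually_ge_at_top[of m] ZQ[OF \<kappa>(1)] UZ[OF \<kappa>(1)] VZ[OF \<kappa>(1) this]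
  show ?thesis
  proof eventually_elim
    fix k
    assume k: "m \<le> k"
      and ZQk: "\<forall>h\<in>BL1 S. \<bar>integral\<^sup>L (N k) (\<lambda>z. h (Z k z)) - integral\<^sup>L Q h\<bar> \<le> \<kappa>"
      and UZk: "\<forall>h\<in>BL1 UNIV.
        \<bar>outer_expectation (M k) (\<lambda>\<omega>. h (U k \<omega>)) - integral\<^sup>L (N k) (\<lambda>z. h (Z k z))\<bar> \<le> \<kappa>"
      and VZk: "outer_measure_of (M k) {\<omega>\<in>space (M k). \<exists>h\<in>BL1 UNIV. \<kappa> <
        \<bar>outer_expectation (L k) (\<lambda>b. h (V k \<omega> b)) - integral\<^sup>L (N k) (\<lambda>z. h (Z k z))\<bar>} \<le> ennreal (e / 2)"
        (is "outer_measure_of _ ?farV \<le> _")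
    \<comment> \<open>Outside this event some \<open>u\<close> in \<open>F\<close> lies within
      \<open>1 / C\<close> of \<open>U k \<omega>\<close>; its outer measure is bounded by Markov's
      inequality for the truncated distance to \<open>F\<close>.\<close>
    let ?farU = "{\<omega>\<in>space (M k). 1 / C \<le> infdist (U k \<omega>) F}"
    let ?t = "\<lambda>x. min (1 / C) (infdist x F)"
    have t: "?t \<in> BL1 UNIV" using C by (intro BL1_min_infdist) auto
    have "outer_measure_of (M k) ?farU \<le> ennreal (outer_expectation (M k) (\<lambda>\<omega>. ?t (U k \<omega>)) / (1 / C))"
      using prob(1) C
      by (intro outer_measure_of_le_outer_expectation[where b="1 / C"]) (auto simp: infdist_nonneg)
    also have "\<dots> \<le> ennreal (e / 2)"
    proof (rule ennreal_leI)
      have "outer_expectation (M k) (\<lambda>\<omega>. ?t (U k \<omega>)) \<le> integral\<^sup>L (N k) (\<lambda>z. ?t (Z k z)) + \<kappa>"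
        using bspec[OF UZk t] by linarith
      then have "C * outer_expectation (M k) (\<lambda>\<omega>. ?t (U k \<omega>))
          \<le> C * (integral\<^sup>L (N k) (\<lambda>z. ?t (Z k z)) + \<kappa>)"
        using C by (intro mult_left_mono) auto
      also have "\<dots> \<le> e / 2" using tail[OF F(1,2) ZQk] \<kappa>(3) \<eta>(2) by (simp add: distrib_left)
      finally show "outer_expectation (M k) (\<lambda>\<omega>. ?t (U k \<omega>)) / (1 / C) \<le> e / 2"
        by (simp add: mult.commute)
    qed
    finally have farU: "outer_measure_of (M k) ?farU \<le> ennreal (e / 2)" .
    have good: "\<bar>outer_expectation (L k) (\<lambda>b. h (f k (U k \<omega>, V k \<omega> b)))
        - integral\<^sup>L (N k) (\<lambda>z. h (\<psi> k (Z k z)))\<bar> \<le> K"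
      if \<omega>: "\<omega> \<in> space (M k)" "\<omega> \<notin> ?farU" "\<omega> \<notin> ?farV" and h: "h \<in> BL1 UNIV" for \<omega> h
    proof -
      have "infdist (U k \<omega>) F < 1 / C" using \<omega> by auto
      then obtain u where u: "u \<in> F" "dist (U k \<omega>) u < 1 / C"
        using F(3) by (auto simp: infdist_notempty cINF_less_iff)
      \<comment> \<open>The section depends on \<open>\<omega>\<close> through \<open>u\<close>, but
        its mass bound and the scale \<open>1 / C\<close> do not, so the estimate is uniform in
        \<open>\<omega>\<close> and \<open>h\<close>.\<close>
      define G where "G = R m `` {u}"
      have G: "closedin (top_of_set S) G" "1 - \<eta> \<le> measure Q G" "G \<noteq> {}"
        using u m(3) nonempty unfolding G_def F_def by auto
      have "\<bar>outer_expectation (L k) (\<lambda>b. h (f k (U k \<omega>, V k \<omega> b)))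
          - integral\<^sup>L (N k) (\<lambda>z. h (\<psi> k (Z k z)))\<bar>
        \<le> 2 * \<epsilon> + 2 * C * \<kappa> + 2 * C * integral\<^sup>L (N k) (\<lambda>z. min (1 / C) (infdist (Z k z) G))"
      proof (rule BL_comparison_near_set[OF prob(2,3) V[OF \<omega>(1)] Z(1) _ h C(1) G(3)])
        have "(\<lambda>x. h (\<psi> k x)) \<in> borel_measurable (restrict_space borel S)"
          using BL1_UNIV_borel_measurable[OF h] borel_measurable_continuous_on_restrict[OF cont(2)]
          by (rule measurable_compose_rev)
        moreover have "Z k \<in> measurable (N k) (restrict_space borel S)"
          using Z by (intro measurable_restrict_space2) auto
        ultimately show "(\<lambda>z. h (\<psi> k (Z k z))) \<in> borel_measurable (N k)"
          by (rule measurable_compose_rev)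
        show "dist (f k (U k \<omega>, V k \<omega> b)) (g a) \<le> \<epsilon>"
          if "b \<in> space (L k)" "a \<in> G" "dist (V k \<omega> b) a < 1 / C" for b a
        proof -
          have "dist (U k \<omega>, V k \<omega> b) (u, a) \<le> dist (U k \<omega>) u + dist (V k \<omega> b) a"
            by (simp add: dist_Pair_Pair sqrt_sum_squares_le_sum)
          also have "\<dots> < 2 / C" using u(2) that(3) by simp
          finally have "dist (U k \<omega>, V k \<omega> b) (u, a) < 2 / real (Suc m)" by (simp add: C_def)
          moreover have "(u, a) \<in> Rf m" using that(2) by (simp add: G_def R_def)
          ultimately show ?thesis
            using k UV[OF \<omega>(1) that(1)] unfolding Rf_def stable_points_def by auto
        qed
        show "dist (\<psi> k (Z k z)) (g a) \<le> \<epsilon>"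
          if "z \<in> space (N k)" "a \<in> G" "dist (Z k z) a < 1 / C" for z a
        proof -
          have "1 / C \<le> 2 / real (Suc m)" by (simp add: C_def frac_le)
          then have "dist (Z k z) a < 2 / real (Suc m)" using that(3) by simp
          moreover have "a \<in> R\<psi> m" using that(2) by (simp add: G_def R_def)
          ultimately show ?thesis
            using k Z(2)[OF that(1)] unfolding R\<psi>_def stable_points_def by auto
        qed
        show "\<bar>integral\<^sup>L (L k) (\<lambda>b. h' (V k \<omega> b)) - integral\<^sup>L (N k) (\<lambda>z. h' (Z k z))\<bar> \<le> \<kappa>"
          if h': "h' \<in> BL1 UNIV" for h'
        proof -
          \<comment> \<open>For fixed data the draw is measurable, so its outer expectation in
            \<open>?farV\<close> is an ordinary integral.\<close>
          have "integrable (L k) (\<lambda>b. h' (V k \<omega> b))"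
            using measurable_compose[OF V[OF \<omega>(1)] BL1_UNIV_borel_measurable[OF h']]
            by (rule integrable_BL1_UNIV[OF prob(2) h'])
          note outer_expectation_eq_integral[OF this]
          moreover have "\<bar>outer_expectation (L k) (\<lambda>b. h' (V k \<omega> b))
              - integral\<^sup>L (N k) (\<lambda>z. h' (Z k z))\<bar> \<le> \<kappa>"
            using \<omega>(1,3) h' by (auto simp: not_less)
          ultimately show ?thesis by simp
        qed
      qed (use pos in simp)
      also have "\<dots> \<le> K"
        using tail[OF G(1,2) ZQk] \<kappa>(2) \<eta>(1) unfolding \<epsilon>_def by linarith
      finally show ?thesis .
    qed
    have "outer_measure_of (M k) {\<omega>\<in>space (M k). \<exists>h\<in>BL1 UNIV. K <
        \<bar>outer_expectation (L k) (\<lambda>b. h (f k (U k \<omega>, V k \<omega> b)))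
          - integral\<^sup>L (N k) (\<lambda>z. h (\<psi> k (Z k z)))\<bar>}
      \<le> outer_measure_of (M k) (?farU \<union> ?farV)"
      by (intro outer_measure_of_mono subsetI) (use good in \<open>force dest: leD\<close>)
    also have "\<dots> \<le> outer_measure_of (M k) ?farU + outer_measure_of (M k) ?farV"
      by (intro outer_measure_of_Un_le) auto
    also have "\<dots> \<le> ennreal (e / 2) + ennreal (e / 2)"
      by (intro add_mono farU VZk)
    also have "\<dots> = ennreal e" using e by (simp flip: ennreal_plus)
    finally show "outer_measure_of (M k) {\<omega>\<in>space (M k). \<exists>h\<in>BL1 UNIV. K <
        \<bar>outer_expectation (L k) (\<lambda>b. h (f k (U k \<omega>, V k \<omega> b)))
          - integral\<^sup>L (N k) (\<lambda>z. h (\<psi> k (Z k z)))\<bar>} \<le> ennreal e" .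
  qed
qed

section \<open>Uniform Hadamard differentiability along sequences\<close>

lemma unif_hadamard_differentiable_quotient:
  assumes "unif_hadamard_differentiable \<phi> D\<phi> D\<rho> D0 \<phi>'"
    and "\<And>n. \<rho>s n \<in> mspace D\<rho>" "limitin (mtopology_of D\<rho>) \<rho>s \<rho> sequentially"
    and "\<And>n. t n \<noteq> 0" "t \<longlonglongrightarrow> 0" "hs \<longlonglongrightarrow> h" "h \<in> D0" "\<And>n. \<rho>s n + t n *\<^sub>R hs n \<in> D\<phi>"
  shows "(\<lambda>n. (\<phi> (\<rho>s n + t n *\<^sub>R hs n) - \<phi> (\<rho>s n)) /\<^sub>R t n) \<longlonglongrightarrow> \<phi>' \<rho> h"
proof -
  have "(\<lambda>n. norm ((\<phi> (\<rho>s n + t n *\<^sub>R hs n) - \<phi> (\<rho>s n)) /\<^sub>R t n - \<phi>' \<rho> h)) \<longlonglongrightarrow> 0"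
    using assms unfolding unif_hadamard_differentiable_def by blast
  then show ?thesis by (rule LIM_zero_cancel[OF tendsto_norm_zero_cancel])
qed

lemma unif_hadamard_differentiable_derivative:
  assumes "unif_hadamard_differentiable \<phi> D\<phi> D\<rho> D0 \<phi>'"
    and "\<And>n. \<rho>s n \<in> mspace D\<rho>" "limitin (mtopology_of D\<rho>) \<rho>s \<rho> sequentially"
    and "\<And>n. hs n \<in> D0" "hs \<longlonglongrightarrow> h" "h \<in> D0"
  shows "(\<lambda>n. \<phi>' (\<rho>s n) (hs n)) \<longlonglongrightarrow> \<phi>' \<rho> h"
proof -
  have "(\<lambda>n. norm (\<phi>' (\<rho>s n) (hs n) - \<phi>' \<rho> h)) \<longlonglongrightarrow> 0"
    using assms unfolding unif_hadamard_differentiable_def by blast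
  then show ?thesis by (rule LIM_zero_cancel[OF tendsto_norm_zero_cancel])
qed

lemma unif_hadamard_differentiable_add:
  assumes "unif_hadamard_differentiable \<phi> D\<phi> D\<rho> D0 \<phi>'"
    and "\<rho> \<in> mspace D\<rho>" "u \<in> D0" "v \<in> D0"
  shows "\<phi>' \<rho> (u + v) = \<phi>' \<rho> u + \<phi>' \<rho> v"
proof -
  have "\<phi>' \<rho> (1 *\<^sub>R u + 1 *\<^sub>R v) = 1 *\<^sub>R \<phi>' \<rho> u + 1 *\<^sub>R \<phi>' \<rho> v"
    using assms unfolding unif_hadamard_differentiable_def by blast
  then show ?thesis by simp
qed

lemma unif_hadamard_differentiable_continuous_on:
  assumes "unif_hadamard_differentiable \<phi> D\<phi> D\<rho> D0 \<phi>'" "\<rho> \<in> mspace D\<rho>"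
  shows "continuous_on D0 (\<phi>' \<rho>)"
  unfolding continuous_on_sequentially
proof clarify
  fix xs x assume "\<forall>n. xs n \<in> D0" "xs \<longlonglongrightarrow> x" "x \<in> D0"
  then show "(\<phi>' \<rho> \<circ> xs) \<longlonglongrightarrow> \<phi>' \<rho> x"
    using unif_hadamard_differentiable_derivative[OF assms(1), of "\<lambda>_. \<rho>" \<rho> xs x] assms(2)
    by (simp add: o_def limitin_const_iff)
qed

text \<open>The perturbed point \<open>\<rho>s n + t n *\<^sub>R us n\<close> may lie outside
  \<open>D\<rho>\<close>, so differentiability is not applied there. Both values of
  \<open>\<phi>\<close> are expanded around \<open>\<rho>s n\<close> instead, and linearity of the
  derivative cancels \<open>u\<close>.\<close>

lemma unif_hadamard_differentiable_increment:
  assumes diff: "unif_hadamard_differentiable \<phi> D\<phi> D\<rho> D0 \<phi>'" and D0: "subspace D0"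
    and \<rho>s: "\<And>n. \<rho>s n \<in> mspace D\<rho>" "limitin (mtopology_of D\<rho>) \<rho>s \<rho> sequentially"
    and t: "\<And>n. t n \<noteq> 0" "t \<longlonglongrightarrow> 0"
    and uv: "us \<longlonglongrightarrow> u" "vs \<longlonglongrightarrow> v" "u \<in> D0" "v \<in> D0"
    and dom: "\<And>n. \<rho>s n + t n *\<^sub>R us n \<in> D\<phi>" "\<And>n. \<rho>s n + t n *\<^sub>R (us n + vs n) \<in> D\<phi>"
  shows "(\<lambda>n. (\<phi> (\<rho>s n + t n *\<^sub>R (us n + vs n)) - \<phi> (\<rho>s n + t n *\<^sub>R us n)) /\<^sub>R t n) \<longlonglongrightarrow> \<phi>' \<rho> v"
proof -
  have "\<rho> \<in> mspace D\<rho>" using \<rho>s(2) by (auto simp: limitin_def)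
  then have eq: "\<phi>' \<rho> (u + v) - \<phi>' \<rho> u = \<phi>' \<rho> v"
    using unif_hadamard_differentiable_add[OF diff _ uv(3,4)] by simp
  have "(\<lambda>n. (\<phi> (\<rho>s n + t n *\<^sub>R (us n + vs n)) - \<phi> (\<rho>s n)) /\<^sub>R t n
      - (\<phi> (\<rho>s n + t n *\<^sub>R us n) - \<phi> (\<rho>s n)) /\<^sub>R t n) \<longlonglongrightarrow> \<phi>' \<rho> (u + v) - \<phi>' \<rho> u"
    using uv subspace_add[OF D0] dom
    by (intro tendsto_diff unif_hadamard_differentiable_quotient[OF diff \<rho>s t] tendsto_add) auto
  then show ?thesis unfolding eq by (simp add: scaleR_diff_right)
qed

section \<open>The delta method for bootstrap draws, uniformly in the law\<close>

theorem theoremB4: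
  fixes \<phi> :: "'d::real_normed_vector \<Rightarrow> 'e::real_normed_vector"
    and D\<phi> D0 :: "'d set" and D\<rho> :: "'d metric" and \<phi>' :: "'d \<Rightarrow> 'd \<Rightarrow> 'e"
    and PP :: "nat \<Rightarrow> 'p set" and n0 :: nat and PPall :: "'p set"
    and M :: "'p \<Rightarrow> 'w measure" and N :: "'p \<Rightarrow> 'z measure"
    and S :: "'x measure" and T :: "'y measure"
    and W :: "'p \<Rightarrow> nat \<Rightarrow> 'w \<Rightarrow> 'x" and \<xi> :: "nat \<Rightarrow> 'w \<Rightarrow> 'y"
    and D :: "nat \<Rightarrow> 'p \<Rightarrow> 'w \<Rightarrow> (nat \<Rightarrow> 'x)" and B :: "nat \<Rightarrow> 'w \<Rightarrow> (nat \<Rightarrow> 'y)"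
    and L :: "nat \<Rightarrow> 'p \<Rightarrow> (nat \<Rightarrow> 'y) measure"
    and r :: "nat \<Rightarrow> real" and \<rho> :: "'p \<Rightarrow> 'd"
    and \<rho>hat :: "nat \<Rightarrow> 'p \<Rightarrow> (nat \<Rightarrow> 'x) \<Rightarrow> 'd"
    and Zs \<rho>star :: "nat \<Rightarrow> 'p \<Rightarrow> (nat \<Rightarrow> 'x) \<Rightarrow> (nat \<Rightarrow> 'y) \<Rightarrow> 'd"
    and Z :: "'p \<Rightarrow> 'z \<Rightarrow> 'd"
  defines "PPall \<equiv> (\<Union>n\<in>{n0..}. PP n)"
    and "D \<equiv> \<lambda>n P. sample_vector (W P) n"
    and "B \<equiv> \<lambda>n. sample_vector \<xi> n"
    and "L \<equiv> \<lambda>n P. distr (M P) (PiM {1..n} (\<lambda>_. T)) (B n)"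
    and "\<rho>star \<equiv> \<lambda>n P d b. \<rho>hat n P d + Zs n P d b /\<^sub>R r n"
  assumes D0: "subspace D0"
    and D\<rho>: "compact_space (mtopology_of D\<rho>)" "mspace D\<rho> \<subseteq> D\<phi>"
    and diff: "unif_hadamard_differentiable \<phi> D\<phi> D\<rho> D0 \<phi>'"
    and prob: "\<And>P. P \<in> PPall \<Longrightarrow> prob_space (M P)" "\<And>P. P \<in> PPall \<Longrightarrow> prob_space (N P)"
    and W: "\<And>n P i. n \<ge> n0 \<Longrightarrow> P \<in> PP n \<Longrightarrow> i \<in> {1..n} \<Longrightarrow> W P i \<in> measurable (M P) S"
    and \<xi>: "\<And>n P i. n \<ge> n0 \<Longrightarrow> P \<in> PP n \<Longrightarrow> i \<in> {1..n} \<Longrightarrow> \<xi> i \<in> measurable (M P) T"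
    and indep: "\<And>n P. n \<ge> n0 \<Longrightarrow> P \<in> PP n \<Longrightarrow>
      prob_space.indep_set (M P)
        (sets (vimage_algebra (space (M P)) (D n P) (PiM {1..n} (\<lambda>_. S))))
        (sets (vimage_algebra (space (M P)) (B n) (PiM {1..n} (\<lambda>_. T))))"
    and r: "filterlim r at_top sequentially"
    and \<rho>: "\<And>P. P \<in> PPall \<Longrightarrow> \<rho> P \<in> mspace D\<rho>"
    and \<rho>hat: "\<And>n P \<omega>. n \<ge> n0 \<Longrightarrow> P \<in> PP n \<Longrightarrow> \<omega> \<in> space (M P) \<Longrightarrow> \<rho>hat n P (D n P \<omega>) \<in> D\<phi>"
    and \<rho>hat_conv:
      "weakly_converges_unif M N PP (\<lambda>n P \<omega>. r n *\<^sub>R (\<rho>hat n P (D n P \<omega>) - \<rho> P)) Z"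
    and Z_sep: "\<And>P. P \<in> PPall \<Longrightarrow> separable_random_element (N P) (Z P)"
    and Z_D0: "\<And>P z. P \<in> PPall \<Longrightarrow> z \<in> space (N P) \<Longrightarrow> Z P z \<in> D0"
    and Z_cpt: "weakly_relatively_compact D0 N PPall Z"
    and Zs_meas: "\<And>n P \<omega>. n \<ge> n0 \<Longrightarrow> P \<in> PP n \<Longrightarrow> \<omega> \<in> space (M P) \<Longrightarrow>
      Zs n P (D n P \<omega>) \<in> borel_measurable (PiM {1..n} (\<lambda>_. T))"
    and \<rho>star: "\<And>n P \<omega> b. n \<ge> n0 \<Longrightarrow> P \<in> PP n \<Longrightarrow> \<omega> \<in> space (M P) \<Longrightarrow>
      b \<in> space (PiM {1..n} (\<lambda>_. T)) \<Longrightarrow> \<rho>star n P (D n P \<omega>) b \<in> D\<phi>"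
    and \<rho>star_conv:
      "weakly_converges_boot_unif M D L N PP (\<lambda>n P d b. r n *\<^sub>R (\<rho>star n P d b - \<rho>hat n P d)) Z"
  shows "weakly_converges_boot_unif M D L N PP
           (\<lambda>n P d b. r n *\<^sub>R (\<phi> (\<rho>star n P d b) - \<phi> (\<rho>hat n P d)))
           (\<lambda>P z. \<phi>' (\<rho> P) (Z P z))"
proof -
  note diffD = unif_hadamard_differentiable_derivative[OF diff]
  define bad where "bad = (\<lambda>K n P. {\<omega>\<in>space (M P). \<exists>h\<in>BL1 UNIV. K <
    \<bar>outer_expectation (L n P) (\<lambda>b. h (r n *\<^sub>R (\<phi> (\<rho>star n P (D n P \<omega>) b) - \<phi> (\<rho>hat n P (D n P \<omega>)))))
      - integral\<^sup>L (N P) (\<lambda>z. h (\<phi>' (\<rho> P) (Z P z)))\<bar>})"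
  have "\<forall>\<^sub>F n in sequentially. (SUP P\<in>PP n. outer_measure_of (M P) (bad K n P)) \<le> ennreal e"
    if K: "K > 0" and e: "e > 0" for K e :: real
  proof (rule ccontr)
    assume neg: "\<not> ?thesis"
    have "\<forall>\<^sub>F n in sequentially. r n > 0"
      using r by (simp add: filterlim_at_top_dense)
    \<comment> \<open>Beyond \<open>n1\<close> the rate is positive, so its inverse is a nonzero
      step as differentiability requires.\<close>
    then obtain n1 where n1: "\<And>n. n \<ge> n1 \<Longrightarrow> r n > 0" by (auto simp: eventually_sequentially)
    have "\<exists>n P. n \<ge> k \<and> n \<ge> n1 \<and> n \<ge> n0 \<and> P \<in> PP n \<and> ennreal e < outer_measure_of (M P) (bad K n P)" for k
    proof -
      obtain n where "n \<ge> max k (max n1 n0)"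
        "\<not> (SUP P\<in>PP n. outer_measure_of (M P) (bad K n P)) \<le> ennreal e"
        using neg unfolding eventually_sequentially by blast
      then show ?thesis by (auto simp: SUP_le_iff not_le)
    qed
    \<comment> \<open>Strict monotonicity of \<open>q\<close> is not demanded;
      \<open>q k \<ge> k\<close> already makes the indices tend to infinity.\<close>
    then obtain q Pq where q: "\<And>k. q k \<ge> k" "\<And>k. q k \<ge> n1" "\<And>k. q k \<ge> n0"
      and Pq: "\<And>k. Pq k \<in> PP (q k)"
      and bad_q: "\<And>k. ennreal e < outer_measure_of (M (Pq k)) (bad K (q k) (Pq k))"
      by metis
    have Pq_all: "Pq k \<in> PPall" for k using Pq q(3) unfolding PPall_def by blast
    obtain s Q where s: "strict_mono s" and Q: "prob_space Q" "sets Q = sets (restrict_space borel D0)"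
      and s_lim: "(\<lambda>k. SUP h\<in>BL1 D0. ennreal \<bar>integral\<^sup>L (N (Pq (s k))) (\<lambda>z. h (Z (Pq (s k)) z))
        - integral\<^sup>L Q h\<bar>) \<longlonglongrightarrow> 0"
      using Z_cpt Pq_all unfolding weakly_relatively_compact_def by blast
    interpret D\<rho>: Metric_space "mspace D\<rho>" "mdist D\<rho>" by simp
    \<comment> \<open>Second extraction, by compactness of \<open>D\<rho>\<close> in its own metric;
      the weak limit \<open>Q\<close> persists along it.\<close>
    have "range (\<lambda>k. \<rho> (Pq (s k))) \<subseteq> mspace D\<rho>" using \<rho> Pq_all by auto
    then obtain \<rho>0 s' where \<rho>0: "\<rho>0 \<in> mspace D\<rho>" and s': "strict_mono s'"
      and \<rho>_lim: "limitin (mtopology_of D\<rho>) ((\<lambda>k. \<rho> (Pq (s k))) \<circ> s') \<rho>0 sequentially"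
      using D\<rho>(1) unfolding mtopology_of_def D\<rho>.compact_space_sequentially by blast
    define j where "j = (\<lambda>k. s (s' k))"
    have j: "k \<le> j k" for k
      unfolding j_def using s s' by (meson order_trans strict_mono_imp_increasing)
    define n where "n = (\<lambda>k. q (j k))"
    define p where "p = (\<lambda>k. Pq (j k))"
    have n: "n k \<ge> k" "n k \<ge> n0" "r (n k) > 0" for k
      using q j[of k] n1 unfolding n_def by (auto intro: order_trans)
    have p: "p k \<in> PP (n k)" "p k \<in> PPall" for k unfolding p_def n_def using Pq Pq_all by auto
    \<comment> \<open>Stated for index maps with \<open>i \<le> \<kappa> i\<close>, the ones along
      which continuous convergence is tested.\<close>
    have n_lim: "filterlim (\<lambda>i. n (\<kappa> i)) at_top sequentially" if "\<And>i. i \<le> \<kappa> i" for \<kappa>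
      using order_trans[OF that n(1)] by (intro filterlim_at_top_mono[OF filterlim_ident]) auto
    define t where "t = (\<lambda>k. inverse (r (n k)))"
    have t: "t k \<noteq> 0" "r (n k) * t k = 1" "t k * r (n k) = 1" for k
      using n(3)[of k] by (auto simp: t_def)
    define U where "U = (\<lambda>k \<omega>. r (n k) *\<^sub>R (\<rho>hat (n k) (p k) (D (n k) (p k) \<omega>) - \<rho> (p k)))"
    define V where "V = (\<lambda>k \<omega>. Zs (n k) (p k) (D (n k) (p k) \<omega>))"
    define f where "f = (\<lambda>k (u, v). (\<phi> (\<rho> (p k) + t k *\<^sub>R (u + v)) - \<phi> (\<rho> (p k) + t k *\<^sub>R u)) /\<^sub>R t k)"
    \<comment> \<open>The pairs for which both arguments of \<open>\<phi>\<close> in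
      \<open>f k\<close> lie in \<open>D\<phi>\<close>.\<close>
    define A where "A = (\<lambda>k. {(u, v). \<rho> (p k) + t k *\<^sub>R u \<in> D\<phi> \<and> \<rho> (p k) + t k *\<^sub>R (u + v) \<in> D\<phi>})"
    have hat: "\<rho> (p k) + t k *\<^sub>R U k \<omega> = \<rho>hat (n k) (p k) (D (n k) (p k) \<omega>)" for k \<omega>
      by (simp add: U_def t)
    have star: "\<rho> (p k) + t k *\<^sub>R (U k \<omega> + V k \<omega> b) = \<rho>star (n k) (p k) (D (n k) (p k) \<omega>) b" for k \<omega> b
      using hat[of k \<omega>] by (simp add: scaleR_add_right \<rho>star_def V_def t_def flip: add.assoc)
    have V_eq: "r (n k) *\<^sub>R (\<rho>star (n k) (p k) (D (n k) (p k) \<omega>) b - \<rho>hat (n k) (p k) (D (n k) (p k) \<omega>))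
        = V k \<omega> b" for k \<omega> b
      using n(3)[of k] by (simp add: \<rho>star_def V_def)
    have X_eq: "r (n k) *\<^sub>R (\<phi> (\<rho>star (n k) (p k) (D (n k) (p k) \<omega>) b) - \<phi> (\<rho>hat (n k) (p k) (D (n k) (p k) \<omega>)))
        = f k (U k \<omega>, V k \<omega> b)" for k \<omega> b
      by (simp add: f_def hat star) (simp add: t_def)
    have sets_L: "sets (L m P) = sets (PiM {1..m} (\<lambda>_. T))" for m P by (simp add: L_def)
    have space_L: "space (L m P) = space (PiM {1..m} (\<lambda>_. T))" for m P by (simp add: L_def)
    have \<rho>p: "\<rho> (p k) \<in> mspace D\<rho>" for k using \<rho> p(2) by blast
    have \<rho>p_lim: "limitin (mtopology_of D\<rho>) (\<lambda>i. \<rho> (p (\<kappa> i))) \<rho>0 sequentially" if "\<And>i. i \<le> \<kappa> i" for \<kappa>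
    proof -
      have "filterlim \<kappa> sequentially sequentially"
        using that by (intro filterlim_at_top_mono[OF filterlim_ident]) auto
      moreover have "limitin (mtopology_of D\<rho>) (\<lambda>k. \<rho> (p k)) \<rho>0 sequentially"
        using \<rho>_lim by (simp add: o_def p_def j_def)
      ultimately show ?thesis
        unfolding limitin_def by (auto intro: eventually_compose_filterlim)
    qed
    have "\<forall>\<^sub>F k in sequentially. outer_measure_of (M (p k)) {\<omega>\<in>space (M (p k)). \<exists>h\<in>BL1 UNIV. K <
        \<bar>outer_expectation (L (n k) (p k)) (\<lambda>b. h (f k (U k \<omega>, V k \<omega> b)))
          - integral\<^sup>L (N (p k)) (\<lambda>z. h (\<phi>' (\<rho> (p k)) (Z (p k) z)))\<bar>} \<le> ennreal e"
    \<comment> \<open>Here \<open>\<psi> k\<close> is \<open>\<phi>' (\<rho> (p k))\<close>: the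
      target law uses the derivative at the moving point, whereas \<open>g\<close> is the derivative
      at the limit \<open>\<rho>0\<close>.\<close>
    proof (rule conditional_extended_continuous_mapping[where Q=Q and S=D0 and A=A and g="\<phi>' \<rho>0"])
      show "prob_space (M (p k))" "prob_space (N (p k))" for k using prob p(2) by auto
      show "prob_space (L (n k) (p k))" for k
        unfolding L_def B_def sample_vector_def
        by (intro prob_space.prob_space_distr prob p measurable_restrict \<xi>[OF n(2) p(1)])
      show "V k \<omega> \<in> borel_measurable (L (n k) (p k))" if "\<omega> \<in> space (M (p k))" for k \<omega>
        unfolding V_def measurable_cong_sets[OF sets_L refl] by (rule Zs_meas[OF n(2) p(1) that])
      show "Z (p k) \<in> borel_measurable (N (p k))" for k
        using Z_sep[OF p(2)] by (simp add: separable_random_element_def)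
      show "Z (p k) z \<in> D0" if "z \<in> space (N (p k))" for k z by (rule Z_D0[OF p(2) that])
      show "prob_space Q" "sets Q = sets (restrict_space borel D0)" by fact+
      show "continuous_on D0 (\<phi>' \<rho>0)" "continuous_on D0 (\<phi>' (\<rho> (p k)))" for k
        using unif_hadamard_differentiable_continuous_on[OF diff] \<rho>0 \<rho>p by auto
      show "(U k \<omega>, V k \<omega> b) \<in> A k" if "\<omega> \<in> space (M (p k))" "b \<in> space (L (n k) (p k))" for k \<omega> b
        using \<rho>hat[OF n(2) p(1) that(1)] \<rho>star[OF n(2) p(1) that(1)] that(2)
        by (simp add: A_def hat star space_L)
      show "(\<lambda>i. f (\<kappa> i) (xs i)) \<longlonglongrightarrow> \<phi>' \<rho>0 (snd x)"
        if "\<And>i. i \<le> \<kappa> i" "\<And>i. xs i \<in> A (\<kappa> i)" "xs \<longlonglongrightarrow> x" "x \<in> D0 \<times> D0" for \<kappa> xs x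
      proof -
        have "(\<lambda>i. t (\<kappa> i)) \<longlonglongrightarrow> 0"
          unfolding t_def
          by (rule tendsto_inverse_0_at_top[OF filterlim_compose[OF r n_lim[OF that(1)]]])
        then have "(\<lambda>i. (\<phi> (\<rho> (p (\<kappa> i)) + t (\<kappa> i) *\<^sub>R (fst (xs i) + snd (xs i)))
            - \<phi> (\<rho> (p (\<kappa> i)) + t (\<kappa> i) *\<^sub>R fst (xs i))) /\<^sub>R t (\<kappa> i)) \<longlonglongrightarrow> \<phi>' \<rho>0 (snd x)"
          using that(2,4)
          by (intro unif_hadamard_differentiable_increment[OF diff D0 \<rho>p \<rho>p_lim[OF that(1)] t(1) _
                tendsto_fst[OF that(3)] tendsto_snd[OF that(3)]])
            (auto simp: A_def case_prod_beta mem_Times_iff)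
        then show ?thesis by (simp add: f_def case_prod_beta)
      qed
      show "(\<lambda>i. \<phi>' (\<rho> (p (\<kappa> i))) (xs i)) \<longlonglongrightarrow> \<phi>' \<rho>0 x"
        if "\<And>i. i \<le> \<kappa> i" "\<And>i. xs i \<in> D0" "xs \<longlonglongrightarrow> x" "x \<in> D0" for \<kappa> xs x
        by (rule diffD[OF \<rho>p \<rho>p_lim[OF that(1)] that(2-4)])
      show "\<forall>\<^sub>F k in sequentially. \<forall>h\<in>BL1 D0.
          \<bar>integral\<^sup>L (N (p k)) (\<lambda>z. h (Z (p k) z)) - integral\<^sup>L Q h\<bar> \<le> \<kappa>" if "\<kappa> > 0" for \<kappa>
      proof -
        have "\<forall>\<^sub>F k in sequentially. (SUP h\<in>BL1 D0. ennreal
            \<bar>integral\<^sup>L (N (p k)) (\<lambda>z. h (Z (p k) z)) - integral\<^sup>L Q h\<bar>) \<le> ennreal \<kappa>"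
          using LIMSEQ_subseq_LIMSEQ[OF s_lim s'] that
          unfolding tendsto_0_ennreal_iff_le by (simp add: o_def p_def j_def)
        then show ?thesis using that by (simp add: SUP_ennreal_abs_le_iff)
      qed
      show "\<forall>\<^sub>F k in sequentially. \<forall>h\<in>BL1 UNIV.
          \<bar>outer_expectation (M (p k)) (\<lambda>\<omega>. h (U k \<omega>)) - integral\<^sup>L (N (p k)) (\<lambda>z. h (Z (p k) z))\<bar> \<le> \<kappa>"
        if "\<kappa> > 0" for \<kappa>
      proof -
        have "\<forall>\<^sub>F m in sequentially. (SUP P\<in>PP m. SUP h\<in>BL1 UNIV. ennreal
            \<bar>outer_expectation (M P) (\<lambda>\<omega>. h (r m *\<^sub>R (\<rho>hat m P (D m P \<omega>) - \<rho> P)))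
              - integral\<^sup>L (N P) (\<lambda>z. h (Z P z))\<bar>) \<le> ennreal \<kappa>"
          using \<rho>hat_conv that unfolding weakly_converges_unif_def tendsto_0_ennreal_iff_le by blast
        from eventually_compose_filterlim[OF this n_lim[of "\<lambda>k. k", OF order_refl]]
        show ?thesis
        proof (eventually_elim)
          fix k assume "(SUP P\<in>PP (n k). SUP h\<in>BL1 UNIV. ennreal
            \<bar>outer_expectation (M P) (\<lambda>\<omega>. h (r (n k) *\<^sub>R (\<rho>hat (n k) P (D (n k) P \<omega>) - \<rho> P)))
              - integral\<^sup>L (N P) (\<lambda>z. h (Z P z))\<bar>) \<le> ennreal \<kappa>"
          from this[unfolded SUP_le_iff, rule_format, OF p(1)] that
          show "\<forall>h\<in>BL1 UNIV. \<bar>outer_expectation (M (p k)) (\<lambda>\<omega>. h (U k \<omega>))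
              - integral\<^sup>L (N (p k)) (\<lambda>z. h (Z (p k) z))\<bar> \<le> \<kappa>"
            by (simp add: U_def)
        qed
      qed
      show "\<forall>\<^sub>F k in sequentially. outer_measure_of (M (p k)) {\<omega>\<in>space (M (p k)). \<exists>h\<in>BL1 UNIV. \<kappa> <
          \<bar>outer_expectation (L (n k) (p k)) (\<lambda>b. h (V k \<omega> b))
            - integral\<^sup>L (N (p k)) (\<lambda>z. h (Z (p k) z))\<bar>} \<le> ennreal \<delta>"
        if "\<kappa> > 0" "\<delta> > 0" for \<kappa> \<delta>
      proof -
        have "\<forall>\<^sub>F m in sequentially. (SUP P\<in>PP m. outer_measure_of (M P) {\<omega>\<in>space (M P). ennreal \<kappa> <
            (SUP h\<in>BL1 UNIV. ennreal \<bar>outer_expectation (L m P)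
                (\<lambda>b. h (r m *\<^sub>R (\<rho>star m P (D m P \<omega>) b - \<rho>hat m P (D m P \<omega>))))
              - integral\<^sup>L (N P) (\<lambda>z. h (Z P z))\<bar>)}) \<le> ennreal \<delta>"
          using \<rho>star_conv that unfolding weakly_converges_boot_unif_def tendsto_0_ennreal_iff_le by blast
        from eventually_compose_filterlim[OF this n_lim[of "\<lambda>k. k", OF order_refl]]
        show ?thesis
        proof (eventually_elim)
          fix k assume "(SUP P\<in>PP (n k). outer_measure_of (M P) {\<omega>\<in>space (M P). ennreal \<kappa> <
            (SUP h\<in>BL1 UNIV. ennreal \<bar>outer_expectation (L (n k) P)
                (\<lambda>b. h (r (n k) *\<^sub>R (\<rho>star (n k) P (D (n k) P \<omega>) b - \<rho>hat (n k) P (D (n k) P \<omega>))))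
              - integral\<^sup>L (N P) (\<lambda>z. h (Z P z))\<bar>)}) \<le> ennreal \<delta>"
          from this[unfolded SUP_le_iff, rule_format, OF p(1)] that(1)
          show "outer_measure_of (M (p k)) {\<omega>\<in>space (M (p k)). \<exists>h\<in>BL1 UNIV. \<kappa> <
              \<bar>outer_expectation (L (n k) (p k)) (\<lambda>b. h (V k \<omega> b))
                - integral\<^sup>L (N (p k)) (\<lambda>z. h (Z (p k) z))\<bar>} \<le> ennreal \<delta>"
            by (simp only: V_eq less_SUP_ennreal_abs_iff less_imp_le)
        qed
      qed
    qed (use K e in auto)
    then have "\<forall>\<^sub>F k in sequentially. outer_measure_of (M (p k)) (bad K (n k) (p k)) \<le> ennreal e"
      by (simp only: bad_def X_eq)
    \<comment> \<open>By \<open>bad_q\<close> the outer measure exceeds \<open>e\<close> at every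
      index, so a single index satisfying the bound is contradictory.\<close>
    then show False
      using bad_q unfolding p_def n_def by (auto simp: eventually_sequentially not_le[symmetric])
  qed
  then show ?thesis
    unfolding weakly_converges_boot_unif_def tendsto_0_ennreal_iff_le bad_def
    by (simp add: less_SUP_ennreal_abs_iff)
qed

end
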